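(* Let $u:\mathbb R^3\to\mathbb R^3$ be divergence free and let the extra linear term $Lu$ be described by a Fourier multiplier with symbol $\ell(\xi)$, i.e. $\widehat{Lu}(\xi)=\ell(\xi)\hat u(\xi)$. (i) If $Lu=a*u$ with $a\in L^1(\mathbb R^3)$, then $\ell(\xi)=\hat a(\xi)$ is bounded, hence $L$ is an order-zero perturbation. In particular, it does not alter the high-frequency scaling of the classical Navier–Stokes equations. (ii) If $Lu=b*\partial_{x_j}u$ with $b\in L^1(\mathbb R^3)$, then $\ell(\xi)=i\xi_j\hat b(\xi)$ is at most first order. If, in addition, $b$ is real and even, then $\hat b$ is real and even, so $\ell(\xi)$ is purely imaginary and contributes no sign to the $L^2$ energy. (iii) If $Lu=c*\partial_{x_jx_j}u$ and $\operatorname{Re}\hat c(\xi)\ge c_*|\xi|^{2\alpha-2}$ for some $\alpha>1$ (with a constant $c_*>0$), then $$\operatorname{Re}\bigl(-\ell(\xi)\bigr)=\xi_j^2\operatorname{Re}\hat c(\xi)\ge c_*\,\xi_j^2|\xi|^{2\alpha-2}.$$ If this lower bound is summed over $j=1,2,3$, then one obtains a dissipative symbol comparable to $|\xi|^{2\alpha}$, and the resulting term is genuinely hyperdissipative.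
   Context: The Fourier transform $\hat f$ is normalized so that $\widehat{f*g}=\hat f\,\hat g$ and $\widehat{\partial_{x_j}f}=i\xi_j\hat f$; $j\in\{1,2,3\}$ is a coordinate index and $*$ is convolution on $\mathbb R^3$. The term $Lu$ is added to the right-hand side of the three-dimensional incompressible Navier–Stokes equations, $\partial_tu+(u\cdot\nabla)u+\nabla p=\nu\Delta u+Lu$, $\operatorname{div}u=0$, with $\nu>0$, so that $\operatorname{Re}(-\ell)\ge0$ corresponds to dissipation. "Order-zero perturbation" means a Fourier multiplier with bounded symbol; "at most first order" means $|\ell(\xi)|\le C|\xi|$; "contributes no sign to the $L^2$ energy" means that the real part of the symbol vanishes in the $L^2$ energy balance. "Comparable to $|\xi|^{2\alpha}$" means two-sided bounds of order $2\alpha$, namely $c_0|\xi|^{2\alpha}\le\operatorname{Re}(-\ell(\xi))\le c_1(1+|\xi|^{2\alpha})$ with constants $0<c_0\le c_1$; "hyperdissipative" means dissipation of order $|\xi|^{2\alpha}$ with $\alpha>1$, stronger than that of the Laplacian. Summing over $j$ refers to the term obtained by adding the second-derivative convolution terms for $j=1,2,3$.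
   Formalization: In (iii) the upper half of "comparable to |ξ|^{2α}" for the summed symbol is proved under the added bound Re ĉ ≤ C(1+|ξ|^{2α-2}), as it fails otherwise; u and its derivatives are taken integrable (also L² for the energy claim), and c is a tempered distribution with ĉ a function. *)

theory Defs
  imports "HOL-Analysis.Analysis" "HOL-Library.Landau_Symbols"
begin

type_synonym R3 = "real ^ 3"

text \<open>Normalization without a prefactor and with kernel \<open>exp (- i x \<bullet> \<xi>)\<close>, so that convolution becomes
  the plain product and \<open>\<partial>\<^sub>j\<close> becomes multiplication by \<open>i \<xi>\<^sub>j\<close>.\<close>

definition fourier :: "(R3 \<Rightarrow> complex) \<Rightarrow> R3 \<Rightarrow> complex" where
  "fourier f \<xi> = (LINT x|lborel. cis (- (x \<bullet> \<xi>)) * f x)"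

definition conv :: "(R3 \<Rightarrow> complex) \<Rightarrow> (R3 \<Rightarrow> complex) \<Rightarrow> R3 \<Rightarrow> complex" where
  "conv f g x = (LINT y|lborel. f y * g (x - y))"

definition cfield :: "(R3 \<Rightarrow> real ^ 3) \<Rightarrow> 3 \<Rightarrow> R3 \<Rightarrow> complex" where
  "cfield u k x = complex_of_real (u x $ k)"


subsection \<open>Schwartz functions, weak derivatives, tempered distributions\<close>

definition pd :: "3 \<Rightarrow> (R3 \<Rightarrow> complex) \<Rightarrow> R3 \<Rightarrow> complex" where
  "pd j f x = frechet_derivative f (at x) (axis j 1)"

definition pds :: "3 list \<Rightarrow> (R3 \<Rightarrow> complex) \<Rightarrow> R3 \<Rightarrow> complex" where
  "pds js f = foldr pd js f"

definition schwartz :: "(R3 \<Rightarrow> complex) \<Rightarrow> bool" where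
  "schwartz \<phi> \<longleftrightarrow>
     (\<forall>js. pds js \<phi> differentiable_on UNIV \<and>
        (\<forall>m::nat. \<exists>C. \<forall>x. norm x ^ m * norm (pds js \<phi> x) \<le> C))"

text \<open>\<open>v\<close> is the weak derivative \<open>\<partial>\<^sub>j\<^sub>s u\<close> of a vector field, both being integrable; for integrable
  functions, testing with Schwartz functions and with compactly supported ones is the same.\<close>

definition weak_deriv :: "3 list \<Rightarrow> (R3 \<Rightarrow> real ^ 3) \<Rightarrow> (R3 \<Rightarrow> real ^ 3) \<Rightarrow> bool" where
  "weak_deriv js u v \<longleftrightarrow>
     integrable lborel u \<and> integrable lborel v \<and>
     (\<forall>k \<phi>. schwartz \<phi> \<longrightarrow>
        (LINT x|lborel. cfield v k x * \<phi> x) =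
          (- 1) ^ length js * (LINT x|lborel. cfield u k x * pds js \<phi> x))"

definition divergence_free :: "(R3 \<Rightarrow> real ^ 3) \<Rightarrow> bool" where
  "divergence_free u \<longleftrightarrow>
     (\<forall>\<phi>. schwartz \<phi> \<longrightarrow> (LINT x|lborel. (\<Sum>k\<in>UNIV. cfield u k x * pd k \<phi> x)) = 0)"

text \<open>A tempered distribution is a functional of which only the values on Schwartz functions matter.
  In the continuity clause \<open>M\<close> ranges over the upper bounds of the \<open>N\<close>-th Schwartz seminorm of \<open>\<phi>\<close>.\<close>

type_synonym dist = "(R3 \<Rightarrow> complex) \<Rightarrow> complex"

definition tempered_distribution :: "dist \<Rightarrow> bool" where
  "tempered_distribution T \<longleftrightarrow>
     (\<forall>\<phi> \<psi>. schwartz \<phi> \<longrightarrow> schwartz \<psi> \<longrightarrow> T (\<lambda>x. \<phi> x + \<psi> x) = T \<phi> + T \<psi>) \<and>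
     (\<forall>z \<phi>. schwartz \<phi> \<longrightarrow> T (\<lambda>x. z * \<phi> x) = z * T \<phi>) \<and>
     (\<exists>N C. \<forall>\<phi> M. schwartz \<phi> \<longrightarrow>
        (\<forall>js x. length js \<le> N \<longrightarrow> (1 + norm x) ^ N * norm (pds js \<phi> x) \<le> M) \<longrightarrow>
        norm (T \<phi>) \<le> C * M)"

definition tempered_fun :: "(R3 \<Rightarrow> complex) \<Rightarrow> bool" where
  "tempered_fun g \<longleftrightarrow>
     g \<in> borel_measurable lborel \<and>
     (\<exists>N::nat. integrable lborel (\<lambda>x. g x / complex_of_real ((1 + norm x) ^ N)))"

text \<open>The distributional Fourier transform of \<open>T\<close>, given by duality, is the function \<open>g\<close>.\<close>

definition has_dist_fourier :: "dist \<Rightarrow> (R3 \<Rightarrow> complex) \<Rightarrow> bool" where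
  "has_dist_fourier T g \<longleftrightarrow>
     tempered_fun g \<and>
     (\<forall>\<phi>. schwartz \<phi> \<longrightarrow> T (fourier \<phi>) = (LINT \<xi>|lborel. g \<xi> * \<phi> \<xi>))"

text \<open>Convolution of a distribution with a function, by transposition:
  \<open>(c * v)(\<phi>) = \<integral> v(x) c(y \<mapsto> \<phi>(x + y)) dx\<close>.  When \<open>c\<close> is a function this is
  \<open>\<integral> (\<integral> c(y) v(z - y) dy) \<phi>(z) dz\<close>.  The integral converges for integrable \<open>v\<close> whenever the
  Fourier transform of \<open>c\<close> is a tempered function, since \<open>x \<mapsto> c(y \<mapsto> \<phi>(x + y))\<close> is then bounded.\<close>

definition dist_conv :: "dist \<Rightarrow> (R3 \<Rightarrow> complex) \<Rightarrow> dist" where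
  "dist_conv c v \<phi> = (LINT x|lborel. v x * c (\<lambda>y. \<phi> (x + y)))"


subsection \<open>Fourier multipliers\<close>

text \<open>\<open>w\<close> (the components of \<open>Lu\<close>) is obtained from \<open>u\<close> by the Fourier multiplier with the scalar
  symbol \<open>\<sigma>\<close>; first for \<open>Lu\<close> a function, then for \<open>Lu\<close> a distribution.\<close>

definition multiplier_relation ::
    "(3 \<Rightarrow> R3 \<Rightarrow> complex) \<Rightarrow> (R3 \<Rightarrow> real ^ 3) \<Rightarrow> (R3 \<Rightarrow> complex) \<Rightarrow> bool" where
  "multiplier_relation w u \<sigma> \<longleftrightarrow>
     (\<forall>k. integrable lborel (w k)) \<and>
     (\<forall>k \<xi>. fourier (w k) \<xi> = \<sigma> \<xi> * fourier (cfield u k) \<xi>)"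

definition dist_multiplier_relation ::
    "(3 \<Rightarrow> dist) \<Rightarrow> (R3 \<Rightarrow> real ^ 3) \<Rightarrow> (R3 \<Rightarrow> complex) \<Rightarrow> bool" where
  "dist_multiplier_relation W u \<sigma> \<longleftrightarrow>
     (\<forall>k. has_dist_fourier (W k) (\<lambda>\<xi>. \<sigma> \<xi> * fourier (cfield u k) \<xi>))"

definition order_zero :: "(R3 \<Rightarrow> complex) \<Rightarrow> bool" where
  "order_zero \<sigma> \<longleftrightarrow> bounded (range \<sigma>)"

definition at_most_first_order :: "(R3 \<Rightarrow> complex) \<Rightarrow> bool" where
  "at_most_first_order \<sigma> \<longleftrightarrow> (\<exists>C. \<forall>\<xi>. norm (\<sigma> \<xi>) \<le> C * norm \<xi>)"

text \<open>The linear part of Navier--Stokes has the symbol \<open>-\<nu>|\<xi>|\<^sup>2\<close>, which is homogeneous of degree 2.  Adding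
  \<open>\<sigma>\<close> leaves it unchanged at leading order as \<open>|\<xi>| \<rightarrow> \<infinity>\<close>, and the parabolic rescaling of the
  perturbed symbol converges to the classical one.\<close>

definition preserves_high_frequency_scaling :: "real \<Rightarrow> (R3 \<Rightarrow> complex) \<Rightarrow> bool" where
  "preserves_high_frequency_scaling \<nu> \<sigma> \<longleftrightarrow>
     (\<lambda>\<xi>. complex_of_real (- \<nu> * (norm \<xi>)\<^sup>2) + \<sigma> \<xi>)
        \<sim>[at_infinity] (\<lambda>\<xi>. complex_of_real (- \<nu> * (norm \<xi>)\<^sup>2)) \<and>
     (\<forall>\<xi>. ((\<lambda>s. (complex_of_real (- \<nu> * (norm (s *\<^sub>R \<xi>))\<^sup>2) + \<sigma> (s *\<^sub>R \<xi>)) / complex_of_real (s\<^sup>2))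
        \<longlongrightarrow> complex_of_real (- \<nu> * (norm \<xi>)\<^sup>2)) at_top)"

definition dissipation_comparable :: "real \<Rightarrow> (R3 \<Rightarrow> complex) \<Rightarrow> bool" where
  "dissipation_comparable \<alpha> \<sigma> \<longleftrightarrow>
     (\<exists>c0 c1. 0 < c0 \<and> c0 \<le> c1 \<and>
        (\<forall>\<xi>. c0 * norm \<xi> powr (2 * \<alpha>) \<le> Re (- \<sigma> \<xi>) \<and>
             Re (- \<sigma> \<xi>) \<le> c1 * (1 + norm \<xi> powr (2 * \<alpha>))))"

definition stronger_than_laplacian :: "(R3 \<Rightarrow> complex) \<Rightarrow> bool" where
  "stronger_than_laplacian \<sigma> \<longleftrightarrow>
     filterlim (\<lambda>\<xi>. Re (- \<sigma> \<xi>) / (norm \<xi>)\<^sup>2) at_top at_infinity"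

definition hyperdissipative :: "real \<Rightarrow> (R3 \<Rightarrow> complex) \<Rightarrow> bool" where
  "hyperdissipative \<alpha> \<sigma> \<longleftrightarrow>
     1 < \<alpha> \<and> dissipation_comparable \<alpha> \<sigma> \<and> stronger_than_laplacian \<sigma>"

end

theory Submission
  imports Defs "HOL-Probability.Distributions" "HOL-Real_Asymp.Real_Asymp"
begin

text \<open>Parts (i) and (iii) reduce to Fubini's theorem.  A weak derivative of an integrable field has the
  expected Fourier transform because the test functions \<open>exp(- i x \<bullet> \<xi>) exp(- |x|\<^sup>2 / n\<^sup>2)\<close> converge
  boundedly to the character, together with their derivatives.  In (iii), \<open>y \<mapsto> (F \<phi>)(x + y)\<close> is the Fourier
  transform of the Schwartz function \<open>\<xi> \<mapsto> exp(- i x \<bullet> \<xi>) \<phi>(\<xi>)\<close>, to which the hypothesis on \<open>c\<close> applies.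

  For the energy in (ii), put \<open>H(y) = \<integral> v(x - y) u(x) dx\<close> with \<open>v = \<partial>\<^sub>j u\<close>; the energy is \<open>\<integral> b H\<close>, so that for even
  \<open>b\<close> it suffices that \<open>H\<close> is odd almost everywhere.  Tested against an even Schwartz function, \<open>H\<close> gives zero.
  Hence all Gaussian averages of \<open>y \<mapsto> H(y) + H(- y)\<close> vanish, and an integrable function with this property is
  zero almost everywhere.\<close>

subsection \<open>Integrals on Euclidean space\<close>

text \<open>The vanishing real part of the symbol suggests Plancherel for the energy. The argument
  with \<open>H\<close> avoids the transform altogether: it needs only absolutely convergent
  integrals in physical space. There \<open>H\<close> is treated merely as an integrable function,
  so its oddness is not read off pointwise but recovered by testing. Square integrability of the
  field and of its derivative makes the double integral behind the energy converge; integrability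
  alone does not control a product of two fields. The Gaussian is the one concrete Schwartz function
  in play, in two roles. Its translates and dilations detect almost-everywhere vanishing, and since
  \<open>gauss 0 = 1\<close>, its ever wider dilations tend to 1 and so remove the damping of a
  character in the limit.\<close>

lemma lborel_integrable_affine:
  fixes f :: "'a::euclidean_space \<Rightarrow> 'b::{banach,second_countable_topology}"
  assumes "integrable lborel f" "c \<noteq> 0"
  shows "integrable lborel (\<lambda>x. f (t + c *\<^sub>R x))"
proof -
  have [measurable]: "f \<in> borel_measurable borel" using assms by auto
  have "integrable (density (distr lborel borel (\<lambda>x. t + c *\<^sub>R x)) (\<lambda>_. \<bar>c\<bar>^DIM('a))) f"
    using assms lborel_affine[of c t] by simp
  then have "integrable lborel (\<lambda>x. \<bar>c\<bar> ^ DIM('a) *\<^sub>R f (t + c *\<^sub>R x))"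
    by (simp add: integrable_density integrable_distr_eq)
  from integrable_scaleR_right[OF this, of "inverse (\<bar>c\<bar> ^ DIM('a))"] show ?thesis
    using assms(2) by simp
qed

lemma lborel_integral_affine:
  fixes f :: "'a::euclidean_space \<Rightarrow> 'b::{banach,second_countable_topology}"
  assumes [measurable]: "f \<in> borel_measurable borel" and "c \<noteq> 0"
  shows "(LINT x|lborel. f x) = \<bar>c\<bar> ^ DIM('a) *\<^sub>R (LINT x|lborel. f (t + c *\<^sub>R x))"
  using assms(2)
  by (subst lborel_affine[of c t]) (simp_all add: integral_density integral_distr)

lemma lborel_integrable_translate:
  fixes f :: "'a::euclidean_space \<Rightarrow> 'b::{banach,second_countable_topology}"
  assumes "integrable lborel f"
  shows "integrable lborel (\<lambda>x. f (x + t))" "integrable lborel (\<lambda>x. f (x - t))"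
    "integrable lborel (\<lambda>x. f (t - x))" "integrable lborel (\<lambda>x. f (- x))"
  using lborel_integrable_affine[OF assms, of 1 t] lborel_integrable_affine[OF assms, of 1 "-t"]
   lborel_integrable_affine[OF assms, of "-1" t] lborel_integrable_affine[OF assms, of "-1" 0]
  by (simp_all add: add.commute)

lemma lborel_integral_translate:
  fixes f :: "'a::euclidean_space \<Rightarrow> 'b::{banach,second_countable_topology}"
  assumes "f \<in> borel_measurable borel"
  shows "(LINT x|lborel. f (x + t)) = (LINT x|lborel. f x)"
    "(LINT x|lborel. f (x - t)) = (LINT x|lborel. f x)"
    "(LINT x|lborel. f (t - x)) = (LINT x|lborel. f x)"
    "(LINT x|lborel. f (- x)) = (LINT x|lborel. f x)"
  using lborel_integral_affine[OF assms, of 1 t] lborel_integral_affine[OF assms, of 1 "-t"]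
   lborel_integral_affine[OF assms, of "-1" t] lborel_integral_affine[OF assms, of "-1" 0]
  by (simp_all add: add.commute)

text \<open>Tonelli applies because the inner integral of \<open>norm g\<close> does not see the
  shift. The shift \<open>s\<close> is arbitrary so that one lemma covers convolutions
  (\<open>uminus\<close>), plain products (zero) and the scaled shifts of Gaussian averages.\<close>

lemma integrable_convolution_kernel:
  fixes f g :: "'a::euclidean_space \<Rightarrow> complex"
  assumes f: "integrable lborel f" and g: "integrable lborel g"
    and s[measurable]: "s \<in> borel_measurable borel"
  shows "integrable (lborel \<Otimes>\<^sub>M lborel) (\<lambda>(y, x). f y * g (x + s y))"
proof (rule lborel_pair.Fubini_integrable)
  have [measurable]: "f \<in> borel_measurable borel" "g \<in> borel_measurable borel"
    using f g by auto
  show "(\<lambda>(y, x). f y * g (x + s y)) \<in> borel_measurable (lborel \<Otimes>\<^sub>M lborel)"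
    by measurable
  have "(LINT x|lborel. norm (g (x + s y))) = (LINT x|lborel. norm (g x))" for y
    by (rule lborel_integral_translate(1)[of "\<lambda>x. norm (g x)"]) measurable
  then show "integrable lborel (\<lambda>y. LINT x|lborel. norm (case (y, x) of (y, x) \<Rightarrow> f y * g (x + s y)))"
    using f by (simp add: norm_mult)
  show "AE y in lborel. integrable lborel (\<lambda>x. case (y, x) of (y, x) \<Rightarrow> f y * g (x + s y))"
    using lborel_integrable_translate(1)[OF g] by simp
qed

text \<open>A bounded weight does not disturb absolute convergence. In use \<open>w\<close> is a
  character, a bounded test function, or a kernel in \<open>x - z\<close>; the energy integral is
  the only later exchange of integrals that needs a separate majorant.\<close>

lemma integral_convolution_kernel:
  fixes f g :: "'a::euclidean_space \<Rightarrow> complex" and w :: "'a \<Rightarrow> 'a \<Rightarrow> complex"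
  assumes f: "integrable lborel f" and g: "integrable lborel g"
    and s[measurable]: "s \<in> borel_measurable borel"
    and w[measurable]: "case_prod w \<in> borel_measurable (lborel \<Otimes>\<^sub>M lborel)"
    and bd: "\<And>y x. norm (w y x) \<le> B"
  shows "integrable (lborel \<Otimes>\<^sub>M lborel) (\<lambda>(y, x). w y x * (f y * g (x + s y)))"
    and "integrable lborel (\<lambda>x. LINT y|lborel. w y x * (f y * g (x + s y)))"
    and "(LINT x|lborel. LINT y|lborel. w y x * (f y * g (x + s y))) =
     (LINT y|lborel. LINT x|lborel. w y x * (f y * g (x + s y)))"
proof -
  have [measurable]: "f \<in> borel_measurable borel" "g \<in> borel_measurable borel"
    using f g by auto
  show *: "integrable (lborel \<Otimes>\<^sub>M lborel) (\<lambda>(y, x). w y x * (f y * g (x + s y)))"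
  proof (rule Bochner_Integration.integrable_bound)
    show "integrable (lborel \<Otimes>\<^sub>M lborel) (\<lambda>z. B * norm (case z of (y, x) \<Rightarrow> f y * g (x + s y)))"
      using integrable_convolution_kernel[OF f g s] by auto
    show "(\<lambda>(y, x). w y x * (f y * g (x + s y))) \<in> borel_measurable (lborel \<Otimes>\<^sub>M lborel)"
      by measurable
    show "AE z in lborel \<Otimes>\<^sub>M lborel. norm (case z of (y, x) \<Rightarrow> w y x * (f y * g (x + s y)))
       \<le> norm (B * norm (case z of (y, x) \<Rightarrow> f y * g (x + s y)))"
      using bd by (auto simp: norm_mult abs_mult intro!: AE_I2 mult_right_mono order_trans[OF bd abs_ge_self])
  qed
  show "integrable lborel (\<lambda>x. LINT y|lborel. w y x * (f y * g (x + s y)))"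
    by (rule lborel_pair.integrable_snd[OF *])
  show "(LINT x|lborel. LINT y|lborel. w y x * (f y * g (x + s y))) =
     (LINT y|lborel. LINT x|lborel. w y x * (f y * g (x + s y)))"
    by (rule lborel_pair.Fubini_integral[OF *])
qed

section \<open>The Gaussian and its integral\<close>

lemma integrable_gaussian:
  "integrable lborel (\<lambda>x::'a::euclidean_space. exp (- (x \<bullet> x)))"
proof (rule integrableI_nonneg)
  \<comment> \<open>With standard deviation \<open>1 / sqrt 2\<close> twice the variance is 1, so
    the normal density is the wanted exponential divided by \<open>sqrt pi\<close>; its zeroth
    moment is scaled back.\<close>
  have 1: "integrable lborel (\<lambda>x::real. exp (- x\<^sup>2))"
    using integrable_mult_right[OF integrable_normal_moment[of "1 / sqrt 2" 0 0], of "sqrt pi"]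
    by (simp add: normal_density_def power_divide)
  have "(\<integral>\<^sup>+ x. ennreal (exp (- (x \<bullet> x))) \<partial>(lborel :: 'a measure))
     = (\<integral>\<^sup>+ x. ennreal (\<Prod>b\<in>Basis. exp (- (x \<bullet> b)\<^sup>2)) \<partial>(lborel :: 'a measure))"
    by (subst euclidean_inner) (simp add: exp_sum sum_negf[symmetric] power2_eq_square)
  also have "\<dots> = (\<integral>\<^sup>+ x. (\<Prod>b\<in>Basis. ennreal (exp (- (x \<bullet> b)\<^sup>2))) \<partial>(lborel :: 'a measure))"
    by (simp add: prod_ennreal)
  also have "\<dots> = (\<Prod>b\<in>(Basis::'a set). (\<integral>\<^sup>+ x. ennreal (exp (- x\<^sup>2)) \<partial>lborel))"
    by (rule nn_integral_lborel_prod) simp_all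
  also have "\<dots> < \<infinity>"
    using 1 by (simp add: nn_integral_eq_integral power_less_top_ennreal)
  finally show "(\<integral>\<^sup>+ x. ennreal (exp (- (x \<bullet> x))) \<partial>(lborel :: 'a measure)) < \<infinity>" .
qed simp_all

text \<open>No normalizing constant: the proof needs \<open>gauss 0 = 1\<close>, while of the
  integral it matters only that it is nonzero.\<close>

definition gauss :: "'a::euclidean_space \<Rightarrow> complex" where
  "gauss x = complex_of_real (exp (- (x \<bullet> x)))"

lemma gauss_integrable: "integrable lborel gauss"
  unfolding gauss_def[abs_def] by (simp only: complex_of_real_integrable_eq integrable_gaussian)

lemma gauss_integral_nonzero: "(LINT x|lborel. gauss (x::'a::euclidean_space)) \<noteq> 0"
proof
  assume "(LINT x|lborel. gauss (x::'a)) = 0"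
  then have "(LINT x|lborel. exp (- ((x::'a) \<bullet> x))) = 0"
    unfolding gauss_def by (simp del: of_real_exp)
  then have "AE x::'a in lborel. exp (- (x \<bullet> x)) = 0"
    by (subst (asm) integral_nonneg_eq_0_iff_AE) (auto simp: integrable_gaussian)
  then have "AE x::'a in lborel. False" by simp
  then have "emeasure (lborel :: 'a measure) UNIV = 0"
    by (subst (asm) AE_iff_measurable[of UNIV]) auto
  then show False by simp
qed

section \<open>Criteria for vanishing almost everywhere\<close>

text \<open>Dynkin's argument: closed sets form an intersection-stable generator of the Borel sets.
  The sets over which \<open>f\<close> integrates to zero are stable under complements, because the
  whole space is itself closed, and under countable disjoint unions.\<close>

lemma AE_zero_if_closed_set_integrals_zero:
  fixes f :: "'a::euclidean_space \<Rightarrow> complex"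
  assumes f: "integrable lborel f"
    and z: "\<And>C. closed C \<Longrightarrow> set_lebesgue_integral lborel C f = 0"
  shows "AE x in lborel. f x = 0"
proof (rule sigma_finite_measure.density_zero[OF sigma_finite_lborel f])
  fix A :: "'a set" assume "A \<in> sets lborel"
  then have A: "A \<in> sigma_sets UNIV (Collect closed)"
    by (simp add: borel_eq_closed)
  have "Int_stable (Collect closed :: 'a set set)" by (auto simp: Int_stable_def)
  moreover have "Collect closed \<subseteq> Pow (UNIV :: 'a set)" by simp
  moreover note A
  ultimately show "set_lebesgue_integral lborel A f = 0"
  proof (induction rule: sigma_sets_induct_disjoint)
    case (basic A) then show ?case using z by simp
  next
    case empty show ?case by (simp add: set_lebesgue_integral_def)
  next
    case (compl A)
    then have A: "A \<in> sets borel" by (simp add: borel_eq_closed)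
    have si: "set_integrable lborel A f" "set_integrable lborel UNIV f"
      using A f by (auto simp: set_integrable_def intro!: integrable_mult_indicator)
    have "set_lebesgue_integral lborel (UNIV - A) f =
      (LINT x|lborel. indicator UNIV x *\<^sub>R f x - indicator A x *\<^sub>R f x)"
      unfolding set_lebesgue_integral_def
      by (intro Bochner_Integration.integral_cong) (auto simp: indicator_def)
    also have "\<dots> = set_lebesgue_integral lborel UNIV f - set_lebesgue_integral lborel A f"
      unfolding set_lebesgue_integral_def
      using si unfolding set_integrable_def by (intro Bochner_Integration.integral_diff)
    finally show ?case using compl z[of UNIV] by simp
  next
    case (union A)
    have A: "A i \<in> sets borel" for i using union(2) by (auto simp: borel_eq_closed)
    have "set_lebesgue_integral lborel (\<Union>i. A i) f = (\<Sum>i. set_lebesgue_integral lborel (A i) f)"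
    proof (rule lebesgue_integral_countable_add)
      show "i \<noteq> j \<Longrightarrow> A i \<inter> A j = {}" for i j using union(1) by (auto simp: disjoint_family_on_def)
      show "set_integrable lborel (\<Union>i. A i) f"
        using A f by (auto simp: set_integrable_def intro!: integrable_mult_indicator)
    qed (use A in auto)
    then show ?case using union(3) by simp
  qed
qed

text \<open>The indicator of a closed set is the pointwise limit of continuous cut-offs with values
  in [0, 1], built from the distance to the set; dominated convergence with majorant
  \<open>norm (f x)\<close> passes to the limit.\<close>

lemma AE_zero_if_continuous_integrals_zero:
  fixes f :: "'a::euclidean_space \<Rightarrow> complex"
  assumes f: "integrable lborel f"
    and z: "\<And>h::'a \<Rightarrow> real. \<lbrakk>continuous_on UNIV h; \<And>x. \<bar>h x\<bar> \<le> 1\<rbrakk> \<Longrightarrow> (LINT x|lborel. h x *\<^sub>R f x) = 0"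
  shows "AE x in lborel. f x = 0"
proof (rule AE_zero_if_closed_set_integrals_zero[OF f])
  have [measurable]: "f \<in> borel_measurable borel" using f by auto
  fix C :: "'a set" assume C: "closed C"
  show "set_lebesgue_integral lborel C f = 0"
  \<comment> \<open>\<open>infdist\<close> to the empty set is 0, which would make the cut-off
    constantly 1 instead of 0.\<close>
  proof (cases "C = {}")
    case False
    define h where "h n x = max 0 (1 - real n * infdist x C)" for n x
    have ch: "continuous_on UNIV (h n)" for n
      unfolding h_def by (intro continuous_intros)
    then have [measurable]: "h n \<in> borel_measurable borel" for n
      by (rule borel_measurable_continuous_onI)
    have bh: "\<bar>h n x\<bar> \<le> 1" for n x
      unfolding h_def by (auto simp: infdist_nonneg)
    have "(\<lambda>n. LINT x|lborel. h n x *\<^sub>R f x) \<longlonglongrightarrow> (LINT x|lborel. indicator C x *\<^sub>R f x)"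
    proof (rule integral_dominated_convergence)
      show "integrable lborel (\<lambda>x. norm (f x))" using f by auto
      show "AE x in lborel. (\<lambda>n. h n x *\<^sub>R f x) \<longlonglongrightarrow> indicator C x *\<^sub>R f x"
      proof (intro AE_I2 tendsto_scaleR tendsto_const)
        fix x
        show "(\<lambda>n. h n x) \<longlonglongrightarrow> indicator C x"
        proof (cases "x \<in> C")
          case True then show ?thesis by (simp add: h_def)
        next
          case F: False
          then have "infdist x C > 0"
            using C False by (simp add: infdist_pos_not_in_closed)
          then have "eventually (\<lambda>n. h n x = 0) sequentially"
          proof -
            assume p: "infdist x C > 0"
            obtain N where "real N * infdist x C > 1" using reals_Archimedean3[OF p] by blast
            then have "h n x = 0" if "n \<ge> N" for n
              unfolding h_def using that p
              by (smt (verit) mult_right_mono of_nat_mono)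
            then show ?thesis unfolding eventually_sequentially by blast
          qed
          then show ?thesis using F by (simp add: tendsto_eventually)
        qed
      qed
      show "AE x in lborel. norm (h n x *\<^sub>R f x) \<le> norm (f x)" for n
        using bh by (intro AE_I2) (simp add: mult_left_le_one_le)
    qed (use C in auto)
    moreover have "(LINT x|lborel. h n x *\<^sub>R f x) = 0" for n by (rule z[OF ch bh])
    ultimately show ?thesis
      unfolding set_lebesgue_integral_def by (simp add: LIMSEQ_const_iff)
  qed (simp add: set_lebesgue_integral_def)
qed

text \<open>For a merely integrable \<open>f\<close> the averages have no evident pointwise limit,
  so the shift is moved onto the continuous \<open>h\<close>. As the width \<open>e\<close> tends to
  0, \<open>F e y\<close> tends to the integral of \<open>h f\<close> for every \<open>y\<close>;
  integrating against \<open>gauss\<close> then gives zero as the product of that integral with the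
  nonzero Gaussian mass.\<close>

lemma AE_zero_if_gauss_averages_zero:
  fixes f :: "'a::euclidean_space \<Rightarrow> complex"
  assumes f: "integrable lborel f"
    and z: "\<And>t e. e > 0 \<Longrightarrow> (LINT y|lborel. gauss y * f (t + e *\<^sub>R y)) = 0"
  shows "AE x in lborel. f x = 0"
proof (rule AE_zero_if_continuous_integrals_zero[OF f])
  have [measurable]: "f \<in> borel_measurable borel" "gauss \<in> borel_measurable (borel :: 'a measure)"
    using f borel_measurable_integrable[OF gauss_integrable] by auto
  fix h :: "'a \<Rightarrow> real" assume h: "continuous_on UNIV h" and bh: "\<And>x. \<bar>h x\<bar> \<le> 1"
  have [measurable]: "h \<in> borel_measurable borel" using h by (rule borel_measurable_continuous_onI)
  define F where "F e y = (LINT t|lborel. h (t - e *\<^sub>R y) *\<^sub>R f t)" for e y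
  have Fm[measurable]: "F e \<in> borel_measurable borel" for e
    unfolding F_def by measurable
  have nF: "norm (F e y) \<le> (LINT t|lborel. norm (f t))" for e y
    unfolding F_def
  proof (rule Bochner_Integration.integral_norm_bound_integral)
    show "integrable lborel (\<lambda>t. h (t - e *\<^sub>R y) *\<^sub>R f t)"
      by (rule Bochner_Integration.integrable_bound[OF f])
       (use bh in \<open>auto simp: mult_left_le_one_le\<close>)
  qed (use f bh in \<open>auto simp: mult_left_le_one_le\<close>)
  have F0: "(LINT y|lborel. gauss y * F e y) = 0" if "e > 0" for e
  proof -
    have "F e y = (LINT t|lborel. h t *\<^sub>R f (t + e *\<^sub>R y))" for y
      unfolding F_def
      using lborel_integral_translate(1)[of "\<lambda>t. h (t - e *\<^sub>R y) *\<^sub>R f t" "e *\<^sub>R y"] by simp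
    then have "(LINT y|lborel. gauss y * F e y) =
       (LINT y|lborel. LINT t|lborel. complex_of_real (h t) * (gauss y * f (t + e *\<^sub>R y)))"
      by (simp add: scaleR_conv_of_real mult.left_commute flip: integral_mult_right_zero)
    also have "\<dots> = (LINT t|lborel. LINT y|lborel. complex_of_real (h t) * (gauss y * f (t + e *\<^sub>R y)))"
      by (rule integral_convolution_kernel(3)[OF gauss_integrable f, where B = 1, symmetric])
         (use bh in \<open>auto\<close>)
    also have "\<dots> = 0" using z[OF that] by simp
    finally show ?thesis .
  qed
  define e where "e n = 1 / real (Suc n)" for n
  have e: "e n > 0" for n by (simp add: e_def)
  have e0: "e \<longlonglongrightarrow> 0" unfolding e_def using LIMSEQ_inverse_real_of_nat by (simp add: inverse_eq_divide)
  have Flim: "(\<lambda>n. F (e n) y) \<longlonglongrightarrow> (LINT t|lborel. h t *\<^sub>R f t)" for y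
    unfolding F_def
  proof (rule integral_dominated_convergence)
    show "integrable lborel (\<lambda>x. norm (f x))" using f by auto
    show "AE t in lborel. (\<lambda>n. h (t - e n *\<^sub>R y) *\<^sub>R f t) \<longlonglongrightarrow> h t *\<^sub>R f t"
    proof (intro AE_I2 tendsto_scaleR tendsto_const)
      fix t
      have "(\<lambda>n. t - e n *\<^sub>R y) \<longlonglongrightarrow> t - 0 *\<^sub>R y" by (intro tendsto_intros e0)
      then show "(\<lambda>n. h (t - e n *\<^sub>R y)) \<longlonglongrightarrow> h t"
        by (intro continuous_on_tendsto_compose[OF h]) auto
    qed
    show "AE t in lborel. norm (h (t - e n *\<^sub>R y) *\<^sub>R f t) \<le> norm (f t)" for n
      using bh by (intro AE_I2) (simp add: mult_left_le_one_le)
  qed measurable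
  have "(\<lambda>n. LINT y|lborel. gauss y * F (e n) y) \<longlonglongrightarrow> (LINT y|lborel. gauss (y::'a) * (LINT t|lborel. h t *\<^sub>R f t))"
  proof (rule integral_dominated_convergence)
    show "integrable lborel (\<lambda>x. norm (gauss (x::'a)) * (LINT t|lborel. norm (f t)))" using gauss_integrable by auto
    show "AE y in lborel. (\<lambda>n. gauss y * F (e n) y) \<longlonglongrightarrow> gauss y * (LINT t|lborel. h t *\<^sub>R f t)"
      by (intro AE_I2 tendsto_mult tendsto_const Flim)
    show "AE y in lborel. norm (gauss y * F (e n) y) \<le> norm (gauss (y::'a)) * (LINT t|lborel. norm (f t))" for n
      using nF by (intro AE_I2) (simp add: norm_mult mult_left_mono)
  qed measurable
  then have "(LINT y|lborel. gauss (y::'a) * (LINT t|lborel. h t *\<^sub>R f t)) = 0"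
    using F0[OF e] by (simp add: LIMSEQ_const_iff)
  then show "(LINT t|lborel. h t *\<^sub>R f t) = 0"
    using gauss_integral_nonzero[where 'a='a] by simp
qed

subsection \<open>Schwartz functions\<close>

lemma pds_Nil [simp]: "pds [] f = f"
  and pds_Cons: "pds (j # js) f = pd j (pds js f)"
  and pds_snoc: "pds (js @ [j]) f = pds js (pd j f)"
  by (simp_all add: pds_def)

lemma pd_eqI: "(f has_derivative D) (at x) \<Longrightarrow> pd j f x = D (axis j 1)"
  unfolding pd_def by (metis frechet_derivative_at)

lemma schwartz_pds: "schwartz \<phi> \<Longrightarrow> schwartz (pds js \<phi>)"
  unfolding schwartz_def pds_def by (metis foldr_append comp_apply)

lemma schwartz_pd: "schwartz \<phi> \<Longrightarrow> schwartz (pd j \<phi>)"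
  using schwartz_pds[of \<phi> "[j]"] by (simp add: pds_Cons)

lemma schwartz_has_derivative:
  assumes "schwartz \<phi>"
  shows "(\<phi> has_derivative frechet_derivative \<phi> (at x)) (at x)"
proof -
  have "pds [] \<phi> differentiable_on UNIV" using assms unfolding schwartz_def by blast
  then show ?thesis by (simp add: differentiable_on_def frechet_derivative_works)
qed

lemma schwartz_differentiable: "schwartz \<phi> \<Longrightarrow> \<phi> differentiable (at x)"
  using schwartz_has_derivative differentiable_def by blast

lemma schwartz_borel: "schwartz \<phi> \<Longrightarrow> \<phi> \<in> borel_measurable borel"
  using schwartz_has_derivative
  by (intro borel_measurable_continuous_onI)
     (meson continuous_at_imp_continuous_on has_derivative_continuous)

text \<open>Trades the weight \<open>norm x ^ m\<close> of the definition for the everywhere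
  positive \<open>(1 + norm x) ^ m\<close>; the factor \<open>2 ^ m\<close> comes from 1 + r \<le> 2
  max(1, r).\<close>

lemma schwartz_bound:
  assumes "schwartz \<phi>"
  obtains C where "\<And>x. (1 + norm x) ^ m * norm (\<phi> x) \<le> C"
proof -
  have *: "\<forall>m. \<exists>C. \<forall>x. norm x ^ m * norm (pds [] \<phi> x) \<le> C"
    using assms unfolding schwartz_def by blast
  obtain C0 where C0: "\<And>x. norm x ^ 0 * norm (\<phi> x) \<le> C0" using *[rule_format, of 0] by auto
  obtain C where C: "\<And>x. norm x ^ m * norm (\<phi> x) \<le> C" using * by auto
  have "(1 + norm x) ^ m * norm (\<phi> x) \<le> 2 ^ m * (C0 + C)" for x
  proof -
    have "(1 + norm x) ^ m \<le> (2 * max 1 (norm x)) ^ m" by (intro power_mono) auto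
    also have "\<dots> \<le> 2 ^ m * (1 + norm x ^ m)"
      by (auto simp: power_mult_distrib max_def)
    finally have "(1 + norm x) ^ m * norm (\<phi> x) \<le> 2 ^ m * (1 + norm x ^ m) * norm (\<phi> x)"
      by (intro mult_right_mono) auto
    also have "\<dots> = 2 ^ m * (norm (\<phi> x) + norm x ^ m * norm (\<phi> x))" by (simp add: algebra_simps)
    also have "\<dots> \<le> 2 ^ m * (C0 + C)" using C0[of x] C[of x] by simp
    finally show ?thesis .
  qed
  then show thesis by (rule that)
qed

text \<open>Coinduction spares any formula for iterated derivatives. It is enough to place the
  function in a family stable under one partial derivative; the families used are the images of all
  Schwartz functions under one operation, and the polynomial multiples of the Gaussian.\<close>

lemma schwartz_coinduct:
  assumes "\<phi> \<in> S"
    and "\<And>f j. f \<in> S \<Longrightarrow> pd j f \<in> S"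
    and "\<And>f x. f \<in> S \<Longrightarrow> f differentiable (at x)"
    and "\<And>f m. f \<in> S \<Longrightarrow> \<exists>C. \<forall>x. (1 + norm x) ^ m * norm (f x) \<le> C"
  shows "schwartz \<phi>"
proof -
  have S: "pds js \<phi> \<in> S" for js
    by (induction js) (auto simp: pds_Cons assms)
  have "\<exists>C. \<forall>x. norm x ^ m * norm (pds js \<phi> x) \<le> C" for js m
  proof -
    obtain C where C: "\<And>x. (1 + norm x) ^ m * norm (pds js \<phi> x) \<le> C"
      using assms(4)[OF S] by blast
    have "norm x ^ m * norm (pds js \<phi> x) \<le> C" for x
      by (rule order_trans[OF _ C[of x]]) (intro mult_right_mono power_mono; simp)
    then show ?thesis by blast
  qed
  then show ?thesis
    unfolding schwartz_def using assms(3)[OF S]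
    by (auto simp: differentiable_on_def)
qed

lemma decay_linear:
  assumes "\<exists>C. \<forall>x. (1 + norm x) ^ m * norm (f x) \<le> C" "\<exists>C. \<forall>x. (1 + norm x) ^ m * norm (g x) \<le> C"
  shows "\<exists>C. \<forall>x. (1 + norm x) ^ m * norm (z * f x + w * g x :: complex) \<le> C"
proof -
  obtain C D where C: "\<And>x. (1 + norm x) ^ m * norm (f x) \<le> C" and D: "\<And>x. (1 + norm x) ^ m * norm (g x) \<le> D"
    using assms by metis
  have "(1 + norm x) ^ m * norm (z * f x + w * g x) \<le> norm z * C + norm w * D" for x
  proof -
    have "(1 + norm x) ^ m * norm (z * f x + w * g x) \<le> (1 + norm x) ^ m * (norm z * norm (f x) + norm w * norm (g x))"
      by (intro mult_left_mono) (auto intro: norm_triangle_le simp: norm_mult)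
    also have "\<dots> = norm z * ((1 + norm x) ^ m * norm (f x)) + norm w * ((1 + norm x) ^ m * norm (g x))"
      by (simp add: algebra_simps)
    also have "\<dots> \<le> norm z * C + norm w * D"
      by (intro add_mono mult_left_mono C D) auto
    finally show ?thesis .
  qed
  then show ?thesis by blast
qed

lemma pd_linear:
  assumes "\<And>x. f differentiable (at x)" "\<And>x. g differentiable (at x)"
  shows "pd j (\<lambda>x. z * f x + w * g x) = (\<lambda>x. z * pd j f x + w * pd j g x)"
proof
  fix x
  show "pd j (\<lambda>x. z * f x + w * g x) x = z * pd j f x + w * pd j g x"
    by (rule pd_eqI[THEN trans])
       (auto intro!: derivative_eq_intros frechet_derivative_works[THEN iffD1] assms simp: pd_def)
qed

lemma schwartz_linear:
  assumes "schwartz f" "schwartz g"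
  shows "schwartz (\<lambda>x. z * f x + w * g x)"
proof (rule schwartz_coinduct[where S = "{\<lambda>x. z * f x + w * g x |f g. schwartz f \<and> schwartz g}"])
  show "(\<lambda>x. z * f x + w * g x) \<in> {\<lambda>x. z * f x + w * g x |f g. schwartz f \<and> schwartz g}"
    using assms by blast
next
  fix h j assume "h \<in> {\<lambda>x. z * f x + w * g x |f g. schwartz f \<and> schwartz g}"
  then show "pd j h \<in> {\<lambda>x. z * f x + w * g x |f g. schwartz f \<and> schwartz g}"
    using pd_linear[OF schwartz_differentiable schwartz_differentiable] schwartz_pd by blast
next
  fix h x assume "h \<in> {\<lambda>x. z * f x + w * g x |f g. schwartz f \<and> schwartz g}"
  then show "h differentiable (at x)"
    using schwartz_differentiable by auto
next
  fix h and m :: nat assume "h \<in> {\<lambda>x. z * f x + w * g x |f g. schwartz f \<and> schwartz g}"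
  then obtain f g where h: "h = (\<lambda>x. z * f x + w * g x)" and fg: "schwartz f" "schwartz g" by blast
  show "\<exists>C. \<forall>x. (1 + norm x) ^ m * norm (h x) \<le> C"
    unfolding h using schwartz_bound[OF fg(1), of m] schwartz_bound[OF fg(2), of m]
    by (intro decay_linear) metis+
qed

lemma pds_linear:
  assumes "schwartz f" "schwartz g"
  shows "pds js (\<lambda>x. z * f x + w * g x) = (\<lambda>x. z * pds js f x + w * pds js g x)"
  by (induction js) (simp_all add: pds_Cons pd_linear schwartz_differentiable schwartz_pds assms)

lemma pd_affine:
  assumes "schwartz f"
  shows "pd j (\<lambda>x. f (t + c *\<^sub>R x)) = (\<lambda>x. complex_of_real c * pd j f (t + c *\<^sub>R x))"
proof
  fix x
  have "((\<lambda>x. f (t + c *\<^sub>R x)) has_derivative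
      (\<lambda>h. frechet_derivative f (at (t + c *\<^sub>R x)) (c *\<^sub>R h))) (at x)"
    by (rule has_derivative_compose[OF _ schwartz_has_derivative[OF assms]])
       (auto intro!: derivative_eq_intros)
  from pd_eqI[OF this]
  show "pd j (\<lambda>x. f (t + c *\<^sub>R x)) x = complex_of_real c * pd j f (t + c *\<^sub>R x)"
    using schwartz_has_derivative[OF assms, THEN has_derivative_linear]
    by (simp add: pd_def linear_scale scaleR_conv_of_real[where 'a = complex])
qed

lemma schwartz_cmult: "schwartz f \<Longrightarrow> schwartz (\<lambda>x. z * f x)"
  using schwartz_linear[of f f z 0] by simp

lemma schwartz_affine:
  assumes "schwartz f" and c: "c \<noteq> 0"
  shows "schwartz (\<lambda>x. f (t + c *\<^sub>R x))"
proof (rule schwartz_coinduct[where S = "{\<lambda>x. f (t + c *\<^sub>R x) |f. schwartz f}"])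
  show "(\<lambda>x. f (t + c *\<^sub>R x)) \<in> {\<lambda>x. f (t + c *\<^sub>R x) |f. schwartz f}"
    using assms by blast
next
  fix h j assume "h \<in> {\<lambda>x. f (t + c *\<^sub>R x) |f. schwartz f}"
  then obtain f where h: "h = (\<lambda>x. f (t + c *\<^sub>R x))" and f: "schwartz f" by blast
  have "schwartz (\<lambda>y. complex_of_real c * pd j f y)" by (intro schwartz_cmult schwartz_pd f)
  then show "pd j h \<in> {\<lambda>x. f (t + c *\<^sub>R x) |f. schwartz f}"
    unfolding h pd_affine[OF f] by (intro CollectI exI[of _ "\<lambda>y. complex_of_real c * pd j f y"]) auto
next
  fix h x assume "h \<in> {\<lambda>x. f (t + c *\<^sub>R x) |f. schwartz f}"
  then obtain f where h: "h = (\<lambda>x. f (t + c *\<^sub>R x))" and f: "schwartz f" by blast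
  show "h differentiable (at x)"
    unfolding h differentiable_def
    by (rule exI, rule has_derivative_compose[OF _ schwartz_has_derivative[OF f]])
       (auto intro!: derivative_eq_intros)
next
  fix h and m :: nat assume "h \<in> {\<lambda>x. f (t + c *\<^sub>R x) |f. schwartz f}"
  then obtain f where h: "h = (\<lambda>x. f (t + c *\<^sub>R x))" and f: "schwartz f" by blast
  obtain C where C: "\<And>x. (1 + norm x) ^ m * norm (f x) \<le> C"
    using schwartz_bound[OF f] by blast
  \<comment> \<open>From \<open>x = (1 / c) *\<^sub>R (y - t)\<close> follows
    \<open>1 + norm x \<le> K * (1 + norm y)\<close>, so \<open>K ^ m\<close> is the price of the
    substitution.\<close>
  define K where "K = 1 + (1 + norm t) / \<bar>c\<bar>"
  have K: "K \<ge> 0" by (simp add: K_def)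
  have "(1 + norm x) ^ m * norm (h x) \<le> K ^ m * C" for x
  proof -
    define y where "y = t + c *\<^sub>R x"
    have "x = (1 / c) *\<^sub>R (y - t)" using c by (simp add: y_def)
    then have "norm x \<le> (norm y + norm t) / \<bar>c\<bar>"
      using norm_triangle_ineq4[of y t] by (simp add: divide_right_mono)
    then have "1 + norm x \<le> 1 + (norm y + norm t) / \<bar>c\<bar>" by simp
    also have "\<dots> \<le> K * (1 + norm y)"
      using c by (simp add: K_def field_simps)
    finally have "(1 + norm x) ^ m * norm (h x) \<le> (K * (1 + norm y)) ^ m * norm (h x)"
      by (intro mult_right_mono power_mono) auto
    also have "\<dots> = K ^ m * ((1 + norm y) ^ m * norm (f y))"
      by (simp add: h y_def power_mult_distrib)
    also have "\<dots> \<le> K ^ m * C" using C K by (intro mult_left_mono) auto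
    finally show ?thesis .
  qed
  then show "\<exists>C. \<forall>x. (1 + norm x) ^ m * norm (h x) \<le> C" by blast
qed

text \<open>The derivative is again a modulated function, with a new amplitude, which makes the
  modulated Schwartz functions a stable family. The coefficient 1 is written out so that the
  amplitude is literally an instance of \<open>schwartz_linear\<close>.\<close>

lemma pd_modulate:
  assumes "schwartz f"
  shows "pd j (\<lambda>x. cis (- (x \<bullet> a)) * f x) =
    (\<lambda>x. cis (- (x \<bullet> a)) * (- \<i> * complex_of_real (a $ j) * f x + 1 * pd j f x))" (is ?pd)
    and "(\<lambda>x. cis (- (x \<bullet> a)) * f x) differentiable (at x)"
proof -
  have e: "((\<lambda>x. cis (- (x \<bullet> a))) has_derivative (\<lambda>h. (- (h \<bullet> a)) *\<^sub>R (\<i> * cis (- (x \<bullet> a))))) (at x)" for x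
    by (auto intro!: derivative_eq_intros)
  have d: "((\<lambda>x. cis (- (x \<bullet> a)) * f x) has_derivative
     (\<lambda>h. cis (- (x \<bullet> a)) * frechet_derivative f (at x) h + (- (h \<bullet> a)) *\<^sub>R (\<i> * cis (- (x \<bullet> a))) * f x)) (at x)" for x
    by (auto intro!: derivative_eq_intros e schwartz_has_derivative assms)
  show ?pd
    by (rule ext, subst pd_eqI[OF d])
       (simp add: pd_def inner_axis' scaleR_conv_of_real algebra_simps)
  show "(\<lambda>x. cis (- (x \<bullet> a)) * f x) differentiable (at x)"
    using d unfolding differentiable_def by blast
qed

lemma schwartz_modulate:
  assumes "schwartz f"
  shows "schwartz (\<lambda>x. cis (- (x \<bullet> a)) * f x)"
proof (rule schwartz_coinduct[where S = "{\<lambda>x. cis (- (x \<bullet> a)) * f x |f. schwartz f}"])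
  show "(\<lambda>x. cis (- (x \<bullet> a)) * f x) \<in> {\<lambda>x. cis (- (x \<bullet> a)) * f x |f. schwartz f}"
    using assms by blast
next
  fix h j assume "h \<in> {\<lambda>x. cis (- (x \<bullet> a)) * f x |f. schwartz f}"
  then show "pd j h \<in> {\<lambda>x. cis (- (x \<bullet> a)) * f x |f. schwartz f}"
  proof clarify
    fix f assume f: "schwartz f"
    have "schwartz (\<lambda>x. - \<i> * complex_of_real (a $ j) * f x + 1 * pd j f x)"
      by (intro schwartz_linear schwartz_pd f)
    then show "\<exists>g. pd j (\<lambda>x. cis (- (x \<bullet> a)) * f x) = (\<lambda>x. cis (- (x \<bullet> a)) * g x) \<and> schwartz g"
      unfolding pd_modulate(1)[OF f]
      by (intro exI[of _ "\<lambda>x. - \<i> * complex_of_real (a $ j) * f x + 1 * pd j f x"]) auto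
  qed
next
  fix h x assume "h \<in> {\<lambda>x. cis (- (x \<bullet> a)) * f x |f. schwartz f}"
  then show "h differentiable (at x)" using pd_modulate(2) by blast
next
  fix h and m :: nat assume "h \<in> {\<lambda>x. cis (- (x \<bullet> a)) * f x |f. schwartz f}"
  then obtain f where h: "h = (\<lambda>x. cis (- (x \<bullet> a)) * f x)" and f: "schwartz f" by blast
  show "\<exists>C. \<forall>x. (1 + norm x) ^ m * norm (h x) \<le> C"
    using schwartz_bound[OF f, of m] by (auto simp: h norm_mult)
qed

section \<open>The Gaussian is a Schwartz function\<close>

lemma coord_has_derivative:
  "((\<lambda>x::R3. complex_of_real (x $ k)) has_derivative (\<lambda>h. complex_of_real (h $ k))) (at x)"
  by (intro has_derivative_of_real bounded_linear.has_derivative[OF bounded_linear_vec_nth] has_derivative_ident)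

text \<open>These are the polynomials times the Gaussian, that is, the span of the Hermite
  functions. Generating them by coordinate multiplication lets both stability under derivatives and
  decay be proved by rule induction.\<close>

inductive_set hermite :: "(R3 \<Rightarrow> complex) set" where
  gauss: "gauss \<in> hermite"
| coord: "f \<in> hermite \<Longrightarrow> (\<lambda>x. complex_of_real (x $ k) * f x) \<in> hermite"
| linear: "f \<in> hermite \<Longrightarrow> g \<in> hermite \<Longrightarrow> (\<lambda>x. z * f x + w * g x) \<in> hermite"

lemma gauss_decay: "\<exists>C. \<forall>x::R3. (1 + norm x) ^ m * norm (gauss x) \<le> C"
proof -
  have "(1 + norm x) ^ m * norm (gauss x) \<le> 2 ^ m * (1 + fact m)" for x :: R3
  proof -
    \<comment> \<open>A single term of the exponential series already beats the power of degree
      \<open>2 * m\<close>, which accounts for the \<open>fact m\<close> in the bound.\<close>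
    have "(\<Sum>k\<in>{m}. (norm x ^ 2) ^ k /\<^sub>R fact k) \<le> exp (norm x ^ 2)"
      unfolding exp_def by (rule sum_le_suminf[OF summable_exp_generic]) auto
    then have 1: "(norm x ^ 2) ^ m \<le> fact m * exp (norm x ^ 2)"
      by (simp add: field_simps)
    have "(1 + norm x) ^ m \<le> (2 * max 1 (norm x ^ 2)) ^ m"
    proof (intro power_mono)
      show "1 + norm x \<le> 2 * max 1 ((norm x)\<^sup>2)"
      proof (cases "norm x \<le> 1")
        case False
        then have "norm x * 1 \<le> norm x * norm x" by (intro mult_left_mono) auto
        then show ?thesis using False by (auto simp: max_def power2_eq_square)
      qed auto
    qed simp
    also have "\<dots> \<le> 2 ^ m * (1 + (norm x ^ 2) ^ m)"
      by (auto simp: power_mult_distrib max_def)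
    also have "\<dots> \<le> 2 ^ m * (exp (norm x ^ 2) + fact m * exp (norm x ^ 2))"
      using 1 by (intro mult_left_mono add_mono) auto
    finally have "(1 + norm x) ^ m * norm (gauss x) \<le>
      2 ^ m * (exp (norm x ^ 2) + fact m * exp (norm x ^ 2)) * norm (gauss x)"
      by (intro mult_right_mono) auto
    also have "\<dots> = 2 ^ m * (exp (norm x ^ 2) + fact m * exp (norm x ^ 2)) * exp (- (norm x ^ 2))"
      by (simp add: gauss_def power2_norm_eq_inner)
    also have "\<dots> = 2 ^ m * (1 + fact m)"
      by (simp add: exp_minus field_simps)
    finally show ?thesis .
  qed
  then show ?thesis by blast
qed

lemma gauss_has_derivative:
  "(gauss has_derivative (\<lambda>h. complex_of_real (- 2 * (x \<bullet> h)) * gauss x)) (at x)"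
  unfolding gauss_def[abs_def]
  by (rule derivative_eq_intros refl)+ (auto simp: inner_commute algebra_simps)

lemma hermite_props:
  assumes "f \<in> hermite"
  shows "f differentiable (at x)" "pd j f \<in> hermite" "\<exists>C. \<forall>x. (1 + norm x) ^ m * norm (f x) \<le> C"
proof -
  have fd: "f differentiable (at x)" if "f \<in> hermite" for f x using that
  proof induction
    case gauss show ?case using gauss_has_derivative differentiable_def by blast
  next
    case (coord f k)
    have "(\<lambda>x::R3. complex_of_real (x $ k)) differentiable (at x)"
      using coord_has_derivative differentiable_def by blast
    then show ?case using coord by simp
  qed simp
  show "f differentiable (at x)" using fd assms .
  have d: "(f has_derivative frechet_derivative f (at x)) (at x)"
    if "\<And>x. f differentiable (at x)" for f :: "R3 \<Rightarrow> complex" and x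
    using that frechet_derivative_works by blast
  show "pd j f \<in> hermite" using assms
  proof induction
    case gauss
    \<comment> \<open>The summand with coefficient 0 gives the derivative the shape demanded by the
      rule \<open>linear\<close>.\<close>
    have "pd j gauss = (\<lambda>x. (-2) * (complex_of_real (x $ j) * gauss x) + 0 * gauss x)"
      by (rule ext, subst pd_eqI[OF gauss_has_derivative]) (simp add: inner_axis)
    then show ?case using hermite.intros by presburger
  next
    case (coord f k)
    have "pd j (\<lambda>x. complex_of_real (x $ k) * f x) =
       (\<lambda>x. (if j = k then 1 else 0) * f x + 1 * (complex_of_real (x $ k) * pd j f x))"
    proof
      fix x
      show "pd j (\<lambda>x. complex_of_real (x $ k) * f x) x =
       (if j = k then 1 else 0) * f x + 1 * (complex_of_real (x $ k) * pd j f x)"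
        by (subst pd_eqI[OF has_derivative_mult[OF coord_has_derivative d[OF fd[OF coord.hyps]]]])
           (simp add: pd_def axis_def)
    qed
    then show ?case using coord hermite.intros by presburger
  next
    case (linear f g z w)
    have "pd j (\<lambda>x. z * f x + w * g x) = (\<lambda>x. z * pd j f x + w * pd j g x)"
      by (intro pd_linear fd linear.hyps)
    then show ?case using linear hermite.intros by presburger
  qed
  show "\<exists>C. \<forall>x. (1 + norm x) ^ m * norm (f x) \<le> C" using assms
  proof (induction arbitrary: m)
    case gauss show ?case by (rule gauss_decay)
  next
    case (coord f k)
    \<comment> \<open>A coordinate factor costs one power of the weight, so the induction hypothesis
      is taken at \<open>Suc m\<close>; hence \<open>m\<close> is arbitrary in the
      induction.\<close>
    obtain C where C: "\<And>x. (1 + norm x) ^ Suc m * norm (f x) \<le> C" using coord.IH by blast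
    have "(1 + norm x) ^ m * norm (complex_of_real (x $ k) * f x) \<le> C" for x
    proof -
      have "(1 + norm x) ^ m * norm (complex_of_real (x $ k) * f x) = (\<bar>x $ k\<bar> * (1 + norm x) ^ m) * norm (f x)"
        by (simp add: norm_mult)
      also have "\<dots> \<le> ((1 + norm x) * (1 + norm x) ^ m) * norm (f x)"
        using component_le_norm_cart[of x k] by (intro mult_right_mono) auto
      also have "\<dots> \<le> C" using C[of x] by simp
      finally show ?thesis .
    qed
    then show ?case by blast
  next
    case (linear f g z w)
    then show ?case by (intro decay_linear)
  qed
qed

lemma schwartz_gauss: "schwartz gauss"
  by (rule schwartz_coinduct[where S = hermite]) (auto intro: hermite.gauss hermite_props)

subsection \<open>Fourier transforms and weak derivatives\<close>

lemma measurable_cis [measurable]: "cis \<in> borel_measurable borel"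
  by (intro borel_measurable_continuous_onI continuous_intros)

lemma integrable_character:
  "integrable lborel f \<Longrightarrow> integrable lborel (\<lambda>x. cis (- (x \<bullet> \<xi>)) * f x)"
  by (rule Bochner_Integration.integrable_bound[of lborel f]) (auto simp: norm_mult)

lemma fourier_norm_le:
  assumes "integrable lborel f"
  shows "norm (fourier f \<xi>) \<le> (LINT x|lborel. norm (f x))"
  unfolding fourier_def
  by (rule Bochner_Integration.integral_norm_bound_integral)
     (use assms integrable_character in \<open>auto simp: norm_mult\<close>)

lemma fourier_borel:
  assumes "integrable lborel f"
  shows "fourier f \<in> borel_measurable borel"
proof -
  have [measurable]: "f \<in> borel_measurable borel" using assms by auto
  show ?thesis unfolding fourier_def[abs_def] by measurable
qed

lemma fourier_translate:
  assumes [measurable]: "f \<in> borel_measurable borel"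
  shows "(LINT x|lborel. cis (- (x \<bullet> \<xi>)) * f (x - y)) = cis (- (y \<bullet> \<xi>)) * fourier f \<xi>"
proof -
  have "(LINT x|lborel. cis (- (x \<bullet> \<xi>)) * f (x - y)) =
     (LINT x|lborel. cis (- ((x + y) \<bullet> \<xi>)) * f ((x + y) - y))"
    by (rule lborel_integral_translate(1)[symmetric]) measurable
  also have "\<dots> = (LINT x|lborel. cis (- (y \<bullet> \<xi>)) * (cis (- (x \<bullet> \<xi>)) * f x))"
    by (simp add: inner_add_left cis_mult mult.assoc[symmetric] add_ac)
  finally show ?thesis by (simp add: fourier_def)
qed

lemma conv_integrable:
  assumes "integrable lborel f" "integrable lborel g"
  shows "integrable lborel (conv f g)"
  using integral_convolution_kernel(2)[OF assms, of uminus "\<lambda>_ _. 1" 1]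
  by (simp add: conv_def[abs_def])

lemma fourier_conv:
  assumes f: "integrable lborel f" and g: "integrable lborel g"
  shows "fourier (conv f g) \<xi> = fourier f \<xi> * fourier g \<xi>"
proof -
  have [measurable]: "g \<in> borel_measurable borel" using g by auto
  have "fourier (conv f g) \<xi> = (LINT x|lborel. LINT y|lborel. cis (- (x \<bullet> \<xi>)) * (f y * g (x + - y)))"
    by (simp add: fourier_def conv_def)
  also have "\<dots> = (LINT y|lborel. LINT x|lborel. cis (- (x \<bullet> \<xi>)) * (f y * g (x + - y)))"
    by (rule integral_convolution_kernel(3)[OF f g, where B = 1]) auto
  also have "\<dots> = (LINT y|lborel. f y * (LINT x|lborel. cis (- (x \<bullet> \<xi>)) * g (x - y)))"
    by (simp add: mult.left_commute flip: integral_mult_right_zero)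
  also have "\<dots> = (LINT y|lborel. (cis (- (y \<bullet> \<xi>)) * f y) * fourier g \<xi>)"
    by (subst fourier_translate) (simp_all add: mult_ac)
  also have "\<dots> = fourier f \<xi> * fourier g \<xi>"
    by (simp add: fourier_def)
  finally show ?thesis .
qed

lemma cfield_integrable: "integrable lborel u \<Longrightarrow> integrable lborel (cfield u k)"
  unfolding cfield_def[abs_def]
  by (intro integrable_of_real) (rule integrable_bounded_linear[OF bounded_linear_vec_nth])

text \<open>The characters are not Schwartz functions, so weak derivatives are tested against characters
  damped by \<open>\<phi>(x / n)\<close>; in the limit all derivatives fall on the character.\<close>

lemma modulated_dilation_pds:
  fixes \<phi> :: "R3 \<Rightarrow> complex" and \<xi> :: R3
  assumes "schwartz \<phi>"
  defines "c \<equiv> \<lambda>n. inverse (real (Suc n))"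
  defines "F \<equiv> \<lambda>\<phi> n x. cis (- (x \<bullet> \<xi>)) * \<phi> (c n *\<^sub>R x)"
  shows "(\<exists>C. \<forall>n x. norm (pds js (F \<phi> n) x) \<le> C) \<and>
    (\<forall>x. (\<lambda>n. pds js (F \<phi> n) x) \<longlonglongrightarrow>
       (\<Prod>j\<leftarrow>js. - \<i> * complex_of_real (\<xi> $ j)) * (cis (- (x \<bullet> \<xi>)) * \<phi> 0))"
  using assms(1)
\<comment> \<open>Peeling off the innermost derivative yields \<open>F \<phi>\<close> with a factor
  from the character, plus \<open>c n\<close> times \<open>F (pd i \<phi>)\<close>. Both have the
  original form, the second with another Schwartz function, hence the generalization over
  \<open>\<phi>\<close>.\<close>
proof (induction js arbitrary: \<phi> rule: rev_induct)
  case Nil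
  obtain C where C: "\<And>x. (1 + norm x) ^ 0 * norm (\<phi> x) \<le> C" using schwartz_bound[OF Nil] by blast
  have "(\<lambda>n. F \<phi> n x) \<longlonglongrightarrow> cis (- (x \<bullet> \<xi>)) * \<phi> 0" for x
  proof -
    have "isCont \<phi> 0" using schwartz_has_derivative[OF Nil] has_derivative_continuous by blast
    moreover have "(\<lambda>n. c n *\<^sub>R x) \<longlonglongrightarrow> 0 *\<^sub>R x"
      unfolding c_def by (intro tendsto_intros LIMSEQ_inverse_real_of_nat)
    ultimately show ?thesis
      unfolding F_def by (intro tendsto_intros) (rule isCont_tendsto_compose, simp_all)
  qed
  then show ?case using C by (auto simp: F_def norm_mult)
next
  case (snoc i js)
  have c1: "\<bar>c n\<bar> \<le> 1" for n
    by (simp add: c_def field_simps)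
  have S: "schwartz (F \<psi> n)" if "schwartz \<psi>" for \<psi> n
    unfolding F_def
    using schwartz_modulate[OF schwartz_affine[OF that, of "c n" 0]] by (simp add: c_def)
  have eq: "pds (js @ [i]) (F \<phi> n) =
     (\<lambda>x. - \<i> * complex_of_real (\<xi> $ i) * pds js (F \<phi> n) x + complex_of_real (c n) * pds js (F (pd i \<phi>) n) x)" for n
  proof -
    have "pd i (F \<phi> n) = (\<lambda>x. - \<i> * complex_of_real (\<xi> $ i) * F \<phi> n x + complex_of_real (c n) * F (pd i \<phi>) n x)"
      unfolding F_def
      using pd_modulate(1)[OF schwartz_affine[OF snoc.prems, of "c n" 0]] pd_affine[OF snoc.prems, of _ 0 "c n"]
      by (simp add: c_def algebra_simps)
    then show ?thesis
      by (simp only: pds_snoc pds_linear[OF S[OF snoc.prems] S[OF schwartz_pd[OF snoc.prems]]])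
  qed
  obtain C where C: "\<And>n x. norm (pds js (F \<phi> n) x) \<le> C" using snoc.IH[OF snoc.prems] by blast
  obtain D where D: "\<And>n x. norm (pds js (F (pd i \<phi>) n) x) \<le> D"
    using snoc.IH[OF schwartz_pd[OF snoc.prems]] by blast
  have "norm (pds (js @ [i]) (F \<phi> n) x) \<le> \<bar>\<xi> $ i\<bar> * C + 1 * D" for n x
  proof -
    have "norm (pds (js @ [i]) (F \<phi> n) x) \<le> norm (- \<i> * complex_of_real (\<xi> $ i) * pds js (F \<phi> n) x)
       + norm (complex_of_real (c n) * pds js (F (pd i \<phi>) n) x)"
      unfolding eq by (rule norm_triangle_ineq)
    also have "\<dots> = \<bar>\<xi> $ i\<bar> * norm (pds js (F \<phi> n) x) + \<bar>c n\<bar> * norm (pds js (F (pd i \<phi>) n) x)"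
      by (simp only: norm_mult norm_minus_cancel norm_ii norm_of_real mult_1)
    also have "\<dots> \<le> \<bar>\<xi> $ i\<bar> * C + 1 * D"
      using c1[of n] by (intro add_mono mult_mono C D abs_ge_zero norm_ge_zero order_refl zero_le_one)
    finally show ?thesis .
  qed
  \<comment> \<open>The term in which the derivative hits the damping carries \<open>c n\<close>,
    which tends to 0, against a convergent factor.\<close>
  moreover have "(\<lambda>n. pds (js @ [i]) (F \<phi> n) x) \<longlonglongrightarrow>
    - \<i> * complex_of_real (\<xi> $ i) * ((\<Prod>j\<leftarrow>js. - \<i> * complex_of_real (\<xi> $ j)) * (cis (- (x \<bullet> \<xi>)) * \<phi> 0))
    + complex_of_real 0 * ((\<Prod>j\<leftarrow>js. - \<i> * complex_of_real (\<xi> $ j)) * (cis (- (x \<bullet> \<xi>)) * pd i \<phi> 0))" for x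
    unfolding eq
    using snoc.IH[OF snoc.prems] snoc.IH[OF schwartz_pd[OF snoc.prems]] LIMSEQ_inverse_real_of_nat
    by (intro tendsto_add tendsto_mult tendsto_const tendsto_of_real) (auto simp: c_def)
  ultimately show ?case by (auto simp: mult_ac)
qed

lemma fourier_weak_deriv:
  assumes "weak_deriv js u v"
  shows "fourier (cfield v k) \<xi> = (\<Prod>j\<leftarrow>js. \<i> * complex_of_real (\<xi> $ j)) * fourier (cfield u k) \<xi>"
proof -
  have int: "integrable lborel (cfield u k)" "integrable lborel (cfield v k)"
    using assms by (auto simp: weak_deriv_def intro: cfield_integrable)
  then have [measurable]: "cfield u k \<in> borel_measurable borel" "cfield v k \<in> borel_measurable borel"
    by auto
  define F where "F n x = cis (- (x \<bullet> \<xi>)) * gauss (inverse (real (Suc n)) *\<^sub>R x)" for n x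
  have S: "schwartz (F n)" for n
    unfolding F_def
    using schwartz_modulate[OF schwartz_affine[OF schwartz_gauss, of "inverse (real (Suc n))" 0]]
    by simp
  \<comment> \<open>One limit for both sides of the weak identity: it is used for \<open>v\<close>
    with the empty list and for \<open>u\<close> with \<open>js\<close>.\<close>
  have lim: "(\<lambda>n. LINT x|lborel. cfield w k x * pds js (F n) x) \<longlonglongrightarrow>
     (\<Prod>j\<leftarrow>js. - \<i> * complex_of_real (\<xi> $ j)) * fourier (cfield w k) \<xi>"
    if w: "integrable lborel (cfield w k)" for w js
  proof -
    have [measurable]: "cfield w k \<in> borel_measurable borel" using w by auto
    have [measurable]: "pds js (F n) \<in> borel_measurable borel" for n
      by (intro schwartz_borel schwartz_pds S)
    note F = modulated_dilation_pds[OF schwartz_gauss, of js \<xi>, folded F_def]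
    obtain C where C: "\<And>n x. norm (pds js (F n) x) \<le> C" using F by blast
    have "(\<lambda>n. LINT x|lborel. cfield w k x * pds js (F n) x) \<longlonglongrightarrow>
       (LINT x|lborel. cfield w k x * ((\<Prod>j\<leftarrow>js. - \<i> * complex_of_real (\<xi> $ j)) * (cis (- (x \<bullet> \<xi>)) * gauss (0::R3))))"
    proof (rule integral_dominated_convergence)
      show "integrable lborel (\<lambda>x. norm (cfield w k x) * C)" using w by auto
      show "AE x in lborel. (\<lambda>n. cfield w k x * pds js (F n) x) \<longlonglongrightarrow>
        cfield w k x * ((\<Prod>j\<leftarrow>js. - \<i> * complex_of_real (\<xi> $ j)) * (cis (- (x \<bullet> \<xi>)) * gauss (0::R3)))"
        using tendsto_mult[OF tendsto_const F[THEN conjunct2, rule_format]] by (intro AE_I2)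
      show "AE x in lborel. norm (cfield w k x * pds js (F n) x) \<le> norm (cfield w k x) * C" for n
        using C by (intro AE_I2) (simp add: norm_mult mult_left_mono)
    qed measurable
    \<comment> \<open>Here \<open>gauss 0 = 1\<close> removes the damping and leaves the bare
      character.\<close>
    also have "(LINT x|lborel. cfield w k x * ((\<Prod>j\<leftarrow>js. - \<i> * complex_of_real (\<xi> $ j)) * (cis (- (x \<bullet> \<xi>)) * gauss (0::R3))))
      = (LINT x|lborel. (\<Prod>j\<leftarrow>js. - \<i> * complex_of_real (\<xi> $ j)) * (cis (- (x \<bullet> \<xi>)) * cfield w k x))"
      by (simp add: gauss_def mult_ac)
    finally show ?thesis by (simp add: fourier_def)
  qed
  have "(\<lambda>n. LINT x|lborel. cfield v k x * F n x) \<longlonglongrightarrow> fourier (cfield v k) \<xi>"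
    using lim[OF int(2), of "[]"] by simp
  moreover have "(LINT x|lborel. cfield v k x * F n x) =
     (- 1) ^ length js * (LINT x|lborel. cfield u k x * pds js (F n) x)" for n
    using assms S unfolding weak_deriv_def by blast
  ultimately have "(\<lambda>n. (- 1) ^ length js * (LINT x|lborel. cfield u k x * pds js (F n) x))
     \<longlonglongrightarrow> fourier (cfield v k) \<xi>" by simp
  moreover have "(\<lambda>n. (- 1) ^ length js * (LINT x|lborel. cfield u k x * pds js (F n) x)) \<longlonglongrightarrow>
     (- 1) ^ length js * ((\<Prod>j\<leftarrow>js. - \<i> * complex_of_real (\<xi> $ j)) * fourier (cfield u k) \<xi>)"
    by (rule tendsto_mult[OF tendsto_const lim[OF int(1)]])
  ultimately have "fourier (cfield v k) \<xi> =
     (- 1) ^ length js * ((\<Prod>j\<leftarrow>js. - \<i> * complex_of_real (\<xi> $ j)) * fourier (cfield u k) \<xi>)"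
    by (rule LIMSEQ_unique)
  \<comment> \<open>Each sign from integration by parts turns one factor
    \<open>- \<i> * \<xi> $ j\<close> into the factor \<open>\<i> * \<xi> $ j\<close> of the
    symbol.\<close>
  moreover have "(- 1) ^ length js * (\<Prod>j\<leftarrow>js. - \<i> * complex_of_real (\<xi> $ j))
      = (\<Prod>j\<leftarrow>js. \<i> * complex_of_real (\<xi> $ j))"
    by (induction js) simp_all
  ultimately show ?thesis by (simp only: mult.assoc[symmetric])
qed

section \<open>Tempered functions and convolution with a distribution\<close>

text \<open>The Schwartz bound is taken at the very exponent \<open>N\<close> that makes
  \<open>g\<close> integrable after division, so the two weights cancel.\<close>

lemma tempered_fun_schwartz_integrable:
  assumes g: "tempered_fun g" and \<phi>: "schwartz \<phi>"
  shows "integrable lborel (\<lambda>\<xi>. g \<xi> * \<phi> \<xi>)"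
proof -
  obtain N where N: "integrable lborel (\<lambda>x. g x / complex_of_real ((1 + norm x) ^ N))"
    using g unfolding tempered_fun_def by blast
  have [measurable]: "g \<in> borel_measurable borel" using g by (simp add: tempered_fun_def)
  have [measurable]: "\<phi> \<in> borel_measurable borel" by (rule schwartz_borel[OF \<phi>])
  obtain C where C: "\<And>x. (1 + norm x) ^ N * norm (\<phi> x) \<le> C" using schwartz_bound[OF \<phi>] by blast
  show ?thesis
  proof (rule Bochner_Integration.integrable_bound)
    show "integrable lborel (\<lambda>x. g x / complex_of_real ((1 + norm x) ^ N) * complex_of_real C)"
      using N by (rule integrable_mult_left)
    have "norm (g x * \<phi> x) \<le> norm (g x / complex_of_real ((1 + norm x) ^ N) * complex_of_real C)" for x
    proof -
      have p: "(1 + norm x) ^ N > 0" by (simp add: add_pos_nonneg)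
      have "norm (\<phi> x) \<le> C / (1 + norm x) ^ N" using C[of x] p by (simp add: pos_le_divide_eq mult.commute)
      moreover have "C \<ge> 0" by (rule order_trans[OF _ C[of x]]) (use p in auto)
      ultimately have "norm (g x) * norm (\<phi> x) \<le> norm (g x) * (C / (1 + norm x) ^ N)"
        by (intro mult_left_mono) auto
      also have "\<dots> = norm (g x / complex_of_real ((1 + norm x) ^ N) * complex_of_real C)"
        unfolding norm_divide norm_mult norm_of_real using p \<open>C \<ge> 0\<close> by simp
      finally show ?thesis unfolding norm_mult[of "g x" "\<phi> x"] .
    qed
    then show "AE x in lborel. norm (g x * \<phi> x) \<le> norm (g x / complex_of_real ((1 + norm x) ^ N) * complex_of_real C)"
      by (rule AE_I2)
  qed measurable
qed

lemma tempered_fun_mult_bounded: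
  assumes g: "tempered_fun g" and h[measurable]: "h \<in> borel_measurable borel"
    and bd: "\<And>x. norm (h x) \<le> K * (1 + norm x) ^ M"
  shows "tempered_fun (\<lambda>x. h x * g x)"
proof -
  obtain N where N: "integrable lborel (\<lambda>x. g x / complex_of_real ((1 + norm x) ^ N))"
    using g unfolding tempered_fun_def by blast
  have [measurable]: "g \<in> borel_measurable borel" using g by (simp add: tempered_fun_def)
  have "integrable lborel (\<lambda>x. h x * g x / complex_of_real ((1 + norm x) ^ (M + N)))"
  proof (rule Bochner_Integration.integrable_bound)
    show "integrable lborel (\<lambda>x. complex_of_real K * (g x / complex_of_real ((1 + norm x) ^ N)))"
      using N by (rule integrable_mult_right)
    have "norm (h x * g x / complex_of_real ((1 + norm x) ^ (M + N)))
      \<le> norm (complex_of_real K * (g x / complex_of_real ((1 + norm x) ^ N)))" for x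
    proof -
      define a where "a = 1 + norm x"
      have a: "a > 0" by (simp add: a_def add_pos_nonneg)
      have "norm (h x) / a ^ M \<le> K"
        using bd[of x] zero_less_power[OF a, of M] by (simp only: a_def pos_divide_le_eq)
      then have "norm (h x) / a ^ M \<le> \<bar>K\<bar>" by linarith
      then have "(norm (h x) / a ^ M) * (norm (g x) / a ^ N) \<le> \<bar>K\<bar> * (norm (g x) / a ^ N)"
        using a by (intro mult_right_mono) auto
      then show ?thesis
        unfolding a_def[symmetric] norm_mult norm_divide norm_of_real
        using a by (simp add: power_add)
    qed
    then show "AE x in lborel. norm (h x * g x / complex_of_real ((1 + norm x) ^ (M + N)))
      \<le> norm (complex_of_real K * (g x / complex_of_real ((1 + norm x) ^ N)))" by (rule AE_I2)
  qed measurable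
  moreover have "(\<lambda>x. h x * g x) \<in> borel_measurable lborel" by measurable
  ultimately show ?thesis unfolding tempered_fun_def by blast
qed

text \<open>Once \<open>c\<close> has been evaluated through \<open>chat\<close>, the pairing is a
  double integral of two integrable functions, \<open>chat * \<phi>\<close> and \<open>v\<close>,
  against a character of modulus 1, so Fubini is available although \<open>c\<close> itself is only
  a distribution.\<close>

lemma dist_conv_fourier:
  assumes c: "has_dist_fourier c chat" and v: "integrable lborel v"
  shows "has_dist_fourier (dist_conv c v) (\<lambda>\<xi>. fourier v \<xi> * chat \<xi>)"
proof -
  have tc: "tempered_fun chat" using c by (simp add: has_dist_fourier_def)
  have [measurable]: "v \<in> borel_measurable borel" "chat \<in> borel_measurable borel"
    using v tc by (auto simp: tempered_fun_def)
  have "dist_conv c v (fourier \<phi>) = (LINT \<xi>|lborel. (fourier v \<xi> * chat \<xi>) * \<phi> \<xi>)"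
    if \<phi>: "schwartz \<phi>" for \<phi>
  proof -
    have ci: "integrable lborel (\<lambda>\<xi>. chat \<xi> * \<phi> \<xi>)"
      by (rule tempered_fun_schwartz_integrable[OF tc \<phi>])
    have "(\<lambda>y. fourier \<phi> (x + y)) = fourier (\<lambda>\<xi>. cis (- (\<xi> \<bullet> x)) * \<phi> \<xi>)" for x
      unfolding fourier_def
      by (intro ext Bochner_Integration.integral_cong refl)
         (simp add: inner_add_right cis_mult mult.assoc[symmetric] inner_commute add_ac)
    then have "c (\<lambda>y. fourier \<phi> (x + y)) = (LINT \<xi>|lborel. chat \<xi> * (cis (- (\<xi> \<bullet> x)) * \<phi> \<xi>))" for x
      using c schwartz_modulate[OF \<phi>] by (simp add: has_dist_fourier_def)
    then have "dist_conv c v (fourier \<phi>) =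
       (LINT x|lborel. LINT \<xi>|lborel. cis (- (x \<bullet> \<xi>)) * ((chat \<xi> * \<phi> \<xi>) * v (x + 0)))"
      unfolding dist_conv_def
      by (simp add: inner_commute mult_ac flip: integral_mult_right_zero)
    also have "\<dots> = (LINT \<xi>|lborel. LINT x|lborel. cis (- (x \<bullet> \<xi>)) * ((chat \<xi> * \<phi> \<xi>) * v (x + 0)))"
      by (rule integral_convolution_kernel(3)[OF ci v, where B = 1]) auto
    also have "\<dots> = (LINT \<xi>|lborel. (fourier v \<xi> * chat \<xi>) * \<phi> \<xi>)"
      unfolding fourier_def
      by (simp add: mult_ac flip: integral_mult_right_zero)
    finally show ?thesis .
  qed
  moreover have "tempered_fun (\<lambda>\<xi>. fourier v \<xi> * chat \<xi>)"
    by (rule tempered_fun_mult_bounded[OF tc fourier_borel[OF v], where M = 0 and K = "LINT x|lborel. norm (v x)"])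
       (use fourier_norm_le[OF v] in auto)
  ultimately show ?thesis unfolding has_dist_fourier_def by blast
qed

text \<open>Temperedness of the sum is a hypothesis of its own: the exponents of the summands may
  differ, and in the application the sum collapses to one product that is checked directly.\<close>

lemma has_dist_fourier_sum:
  assumes T: "\<And>i. i \<in> I \<Longrightarrow> has_dist_fourier (T i) (g i)"
    and g: "tempered_fun (\<lambda>\<xi>. \<Sum>i\<in>I. g i \<xi>)"
  shows "has_dist_fourier (\<lambda>\<phi>. \<Sum>i\<in>I. T i \<phi>) (\<lambda>\<xi>. \<Sum>i\<in>I. g i \<xi>)"
  unfolding has_dist_fourier_def
proof (intro conjI g allI impI)
  fix \<phi> assume \<phi>: "schwartz \<phi>"
  have "integrable lborel (\<lambda>\<xi>. g i \<xi> * \<phi> \<xi>)" if "i \<in> I" for i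
    using T[OF that] tempered_fun_schwartz_integrable \<phi> by (auto simp: has_dist_fourier_def)
  then show "(\<Sum>i\<in>I. T i (fourier \<phi>)) = (LINT \<xi>|lborel. (\<Sum>i\<in>I. g i \<xi>) * \<phi> \<xi>)"
    using T \<phi> by (simp add: sum_distrib_right has_dist_fourier_def)
qed

subsection \<open>The energy of an even convolution\<close>

lemma schwartz_reflect: "schwartz \<psi> \<Longrightarrow> schwartz (\<lambda>z. \<psi> (x - z))"
  using schwartz_affine[of \<psi> "-1" x] by simp

lemma schwartz_norm_le: "schwartz \<phi> \<Longrightarrow> \<exists>B. \<forall>x. norm (\<phi> x) \<le> B"
  using schwartz_bound[of \<phi> 0] by auto

text \<open>Moving the derivative from \<open>g\<close> to \<open>\<psi>\<close> leaves a double integral of \<open>f \<otimes> f\<close> against the odd kernel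
  \<open>\<partial>\<^sub>j\<psi>(x - z)\<close>.\<close>

lemma correlation_even_schwartz_zero:
  fixes f g :: "R3 \<Rightarrow> complex"
  assumes f: "integrable lborel f" and g: "integrable lborel g"
    and weak: "\<And>\<phi>. schwartz \<phi> \<Longrightarrow> (LINT x|lborel. g x * \<phi> x) = - (LINT x|lborel. f x * pd j \<phi> x)"
    and \<psi>: "schwartz \<psi>" and even: "\<And>x. \<psi> (- x) = \<psi> x"
  shows "(LINT y|lborel. \<psi> y * conv f (\<lambda>z. g (- z)) y) = 0"
proof -
  have [measurable]: "f \<in> borel_measurable borel" "g \<in> borel_measurable borel" using f g by auto
  define \<eta> where "\<eta> = pd j \<psi>"
  have [measurable]: "\<psi> \<in> borel_measurable borel" "\<eta> \<in> borel_measurable borel"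
    unfolding \<eta>_def using \<psi> by (auto intro: schwartz_borel schwartz_pd)
  obtain B where B: "\<And>x. norm (\<psi> x) \<le> B" using schwartz_norm_le[OF \<psi>] by blast
  obtain D where D: "\<And>x. norm (\<eta> x) \<le> D"
    using schwartz_norm_le[OF schwartz_pd[OF \<psi>]] unfolding \<eta>_def by blast
  have pd_reflect: "pd j (\<lambda>z. \<psi> (x - z)) = (\<lambda>z. - \<eta> (x - z))" for x
    using pd_affine[OF \<psi>, of j x "-1"] by (simp add: \<eta>_def)
  \<comment> \<open>Reflection at \<open>x = 0\<close> leaves an even \<open>\<psi>\<close>
    unchanged, so \<open>pd_reflect\<close> compares \<open>\<eta>\<close> with its own
    reflection.\<close>
  have odd: "\<eta> (- x) = - \<eta> x" for x
    using fun_cong[OF pd_reflect[of 0], of x] by (simp add: even \<eta>_def)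
  define E where "E = (LINT x|lborel. LINT z|lborel. \<eta> (x - z) * (f x * f (z + 0)))"
  have "(LINT y|lborel. \<psi> y * conv f (\<lambda>z. g (- z)) y)
    = (LINT y|lborel. LINT x|lborel. \<psi> y * (f x * g (- (y + - x))))"
    unfolding conv_def by simp
  also have "\<dots> = (LINT x|lborel. LINT y|lborel. \<psi> y * (f x * g (- (y + - x))))"
    by (rule integral_convolution_kernel(3)[OF f lborel_integrable_translate(4)[OF g], where B = B])
       (auto simp: B)
  also have "\<dots> = (LINT x|lborel. f x * (LINT y|lborel. g (x - y) * \<psi> y))"
    by (simp add: mult_ac flip: integral_mult_right_zero)
  also have "\<dots> = (LINT x|lborel. f x * (LINT z|lborel. g z * \<psi> (x - z)))"
  proof -
    have "(LINT y|lborel. g (x - y) * \<psi> y) = (LINT z|lborel. g z * \<psi> (x - z))" for x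
      using lborel_integral_translate(3)[of "\<lambda>z. g z * \<psi> (x - z)" x] by simp
    then show ?thesis by simp
  qed
  \<comment> \<open>Two signs cancel: one from the weak derivative, one from differentiating
    \<open>\<psi> (x - z)\<close> in \<open>z\<close>.\<close>
  also have "\<dots> = E"
    unfolding E_def using weak[OF schwartz_reflect[OF \<psi>]]
    by (simp add: pd_reflect mult_ac flip: integral_mult_right_zero)
  also have "E = 0"
  proof -
    have "E = (LINT z|lborel. LINT x|lborel. \<eta> (x - z) * (f x * f (z + 0)))"
      unfolding E_def
      by (rule integral_convolution_kernel(3)[OF f f, where B = D, symmetric]) (auto simp: D)
    \<comment> \<open>After the exchange of integrals, oddness of \<open>\<eta>\<close> gives back
      \<open>E\<close> with its bound variables renamed and a minus sign, so
      \<open>E = - E\<close>.\<close>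
    also have "\<dots> = (LINT z|lborel. LINT x|lborel. - (\<eta> (z - x) * (f z * f (x + 0))))"
    proof (intro Bochner_Integration.integral_cong refl)
      fix z x
      show "\<eta> (x - z) * (f x * f (z + 0)) = - (\<eta> (z - x) * (f z * f (x + 0)))"
        using odd[of "z - x"] by simp
    qed
    also have "\<dots> = - E"
      unfolding E_def by (simp only: Bochner_Integration.integral_minus)
    finally show ?thesis by simp
  qed
  finally show ?thesis .
qed

text \<open>A Gaussian centred at \<open>t\<close> is not even. Pairing it with the symmetrized
  \<open>H\<close>, however, is the same as pairing its symmetrization with \<open>H\<close>, and
  that test function is even and Schwartz.\<close>

lemma correlation_antisymmetric:
  fixes f g :: "R3 \<Rightarrow> complex"
  assumes f: "integrable lborel f" and g: "integrable lborel g"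
    and weak: "\<And>\<phi>. schwartz \<phi> \<Longrightarrow> (LINT x|lborel. g x * \<phi> x) = - (LINT x|lborel. f x * pd j \<phi> x)"
  defines "H \<equiv> conv f (\<lambda>z. g (- z))"
  shows "AE y in lborel. H y + H (- y) = 0"
proof (rule AE_zero_if_gauss_averages_zero)
  have H: "integrable lborel H"
    unfolding H_def by (intro conv_integrable f lborel_integrable_translate(4) g)
  then show W: "integrable lborel (\<lambda>y. H y + H (- y))"
    by (intro Bochner_Integration.integrable_add lborel_integrable_translate(4))
  have [measurable]: "H \<in> borel_measurable borel" using H by auto
  fix t :: R3 and e :: real assume e: "e > 0"
  \<comment> \<open>Chosen so that \<open>\<phi> (t + e *\<^sub>R y) = gauss y\<close>: an affine
    change of variables turns the average at \<open>t\<close> and \<open>e\<close> into the pairing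
    with \<open>\<phi>\<close>, up to a nonzero power of \<open>e\<close>.\<close>
  define \<phi> where "\<phi> z = gauss (- (1 / e) *\<^sub>R t + (1 / e) *\<^sub>R z)" for z
  have \<phi>: "schwartz \<phi>"
    unfolding \<phi>_def[abs_def] using e by (intro schwartz_affine schwartz_gauss) auto
  then have \<phi>m: "schwartz (\<lambda>z. \<phi> (- z))" using schwartz_reflect[of \<phi> 0] by simp
  have [measurable]: "\<phi> \<in> borel_measurable borel" using \<phi> by (rule schwartz_borel)
  obtain B where B: "\<And>x. norm (\<phi> x) \<le> B" using schwartz_norm_le[OF \<phi>] by blast
  have B0: "0 \<le> B" using B[of 0] norm_ge_zero order_trans by blast
  have int: "integrable lborel (\<lambda>z. p z * H z)"
    if [measurable]: "p \<in> borel_measurable borel" and "\<And>z. norm (p z) \<le> B" for p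
    by (rule Bochner_Integration.integrable_bound[OF integrable_mult_right[OF H, of "complex_of_real B"]])
       (auto simp: norm_mult B0 intro!: mult_right_mono that)
  have i1: "integrable lborel (\<lambda>z. \<phi> z * H z)" and i2: "integrable lborel (\<lambda>z. \<phi> (- z) * H z)"
    by (auto intro!: int B)
  have "(LINT z|lborel. \<phi> z * (H z + H (- z)))
     = (LINT z|lborel. \<phi> z * H z) + (LINT z|lborel. \<phi> z * H (- z))"
    using i1 lborel_integrable_translate(4)[OF i2] by (simp add: distrib_left)
  also have "(LINT z|lborel. \<phi> z * H (- z)) = (LINT z|lborel. \<phi> (- z) * H z)"
    using lborel_integral_translate(4)[of "\<lambda>z. \<phi> (- z) * H z"] by simp
  also have "(LINT z|lborel. \<phi> z * H z) + (LINT z|lborel. \<phi> (- z) * H z)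
     = (LINT z|lborel. (1 * \<phi> z + 1 * \<phi> (- z)) * H z)"
    using i1 i2 by (simp add: distrib_right)
  also have "\<dots> = 0"
    unfolding H_def
    by (rule correlation_even_schwartz_zero[OF f g weak schwartz_linear[OF \<phi> \<phi>m]]) auto
  finally have "(LINT z|lborel. \<phi> z * (H z + H (- z))) = 0" .
  moreover have "(LINT z|lborel. \<phi> z * (H z + H (- z))) =
    \<bar>e\<bar> ^ DIM(R3) *\<^sub>R (LINT y|lborel. \<phi> (t + e *\<^sub>R y) * (H (t + e *\<^sub>R y) + H (- (t + e *\<^sub>R y))))"
    using e by (intro lborel_integral_affine) auto
  moreover have "\<phi> (t + e *\<^sub>R y) = gauss y" for y
    using e by (simp add: \<phi>_def scaleR_add_right)
  ultimately show "(LINT y|lborel. gauss y * (H (t + e *\<^sub>R y) + H (- (t + e *\<^sub>R y)))) = 0"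
    using e by simp
qed

text \<open>Fubini rewrites the energy as the integral of \<open>b\<close> times the correlation
  \<open>H\<close>, and an even function times an almost everywhere odd one integrates to zero. The
  product carries no conjugate, since it is applied to components of real fields.\<close>

lemma even_convolution_derivative_energy:
  fixes b f g :: "R3 \<Rightarrow> complex"
  assumes b: "integrable lborel b" and f: "integrable lborel f" and g: "integrable lborel g"
    and f2: "integrable lborel (\<lambda>x. (norm (f x))\<^sup>2)" and g2: "integrable lborel (\<lambda>x. (norm (g x))\<^sup>2)"
    and even: "AE x in lborel. b (- x) = b x"
    and weak: "\<And>\<phi>. schwartz \<phi> \<Longrightarrow> (LINT x|lborel. g x * \<phi> x) = - (LINT x|lborel. f x * pd j \<phi> x)"
  shows "has_bochner_integral lborel (\<lambda>x. conv b g x * f x) 0"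
proof -
  have [measurable]: "b \<in> borel_measurable borel" "f \<in> borel_measurable borel" "g \<in> borel_measurable borel"
    using b f g by auto
  define H where "H = conv f (\<lambda>z. g (- z))"
  have "integrable lborel H"
    unfolding H_def by (intro conv_integrable f lborel_integrable_translate(4) g)
  then have [measurable]: "H \<in> borel_measurable borel" by auto
  have K: "integrable (lborel \<Otimes>\<^sub>M lborel) (\<lambda>(y, x). b y * (g (x - y) * f x))"
  proof (rule Bochner_Integration.integrable_bound)
    \<comment> \<open>The majorant comes from p q \<le> p^2 + q^2. Each square is an integrable
      function in its own right, so the kernel lemma applies to it, with shift \<open>uminus\<close>
      for \<open>g\<close> and zero for \<open>f\<close>.\<close>
    have sq: "integrable (lborel \<Otimes>\<^sub>M lborel) (\<lambda>(y, x). b y * complex_of_real ((norm (h (x + s y)))\<^sup>2))"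
      if "integrable lborel (\<lambda>x. (norm (h x))\<^sup>2)" and [measurable]: "s \<in> borel_measurable borel"
      for h :: "R3 \<Rightarrow> complex" and s
      by (rule integrable_convolution_kernel[OF b]) (use that in \<open>auto simp del: of_real_power\<close>)
    have "integrable (lborel \<Otimes>\<^sub>M lborel) (\<lambda>z. norm (case z of (y, x) \<Rightarrow> b y * complex_of_real ((norm (g (x + - y)))\<^sup>2))
       + norm (case z of (y, x) \<Rightarrow> b y * complex_of_real ((norm (f (x + 0)))\<^sup>2)))"
      using sq[OF g2, of uminus] sq[OF f2, of "\<lambda>_. 0"]
      by (intro Bochner_Integration.integrable_add integrable_norm) auto
    then show "integrable (lborel \<Otimes>\<^sub>M lborel)
       (\<lambda>(y, x). norm (b y) * ((norm (g (x - y)))\<^sup>2 + (norm (f x))\<^sup>2))"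
      by (simp add: case_prod_unfold norm_mult norm_power distrib_left)
    show "(\<lambda>(y, x). b y * (g (x - y) * f x)) \<in> borel_measurable (lborel \<Otimes>\<^sub>M lborel)"
      by measurable
    have "p * q \<le> p\<^sup>2 + q\<^sup>2" if "p \<ge> 0" "q \<ge> 0" for p q :: real
      using that sum_squares_bound[of p q] mult_nonneg_nonneg[OF that] by linarith
    then show "AE z in lborel \<Otimes>\<^sub>M lborel. norm (case z of (y, x) \<Rightarrow> b y * (g (x - y) * f x))
      \<le> norm (case z of (y, x) \<Rightarrow> norm (b y) * ((norm (g (x - y)))\<^sup>2 + (norm (f x))\<^sup>2))"
      by (intro AE_I2) (auto simp: norm_mult intro!: mult_left_mono)
  qed
  have "integrable lborel (\<lambda>x. conv b g x * f x)"
    using lborel_pair.integrable_snd[OF K] by (simp add: conv_def mult.assoc flip: integral_mult_left_zero)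
  moreover have "(LINT x|lborel. conv b g x * f x) = 0"
  proof -
    have H': "(LINT x|lborel. b y * (g (x - y) * f x)) = b y * H y" for y
      by (simp add: H_def conv_def mult_ac)
    have bH: "integrable lborel (\<lambda>y. b y * H y)"
      using lborel_pair.integrable_fst[OF K] by (simp only: H')
    have "(LINT x|lborel. conv b g x * f x) = (LINT x|lborel. LINT y|lborel. b y * (g (x - y) * f x))"
      by (simp add: conv_def mult.assoc flip: integral_mult_left_zero)
    also have "\<dots> = (LINT y|lborel. b y * H y)"
      using lborel_pair.Fubini_integral[OF K] by (simp only: H')
    finally have I: "(LINT x|lborel. conv b g x * f x) = (LINT y|lborel. b y * H y)" .
    \<comment> \<open>Reflecting \<open>y\<close> shows that the integral equals its own
      negative.\<close>
    have "(LINT y|lborel. b y * H y) = (LINT y|lborel. b (- y) * H (- y))"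
      by (rule lborel_integral_translate(4)[symmetric]) measurable
    also have "\<dots> = (LINT y|lborel. - (b y * H y))"
    proof (rule integral_cong_AE)
      have "AE y in lborel. H y + H (- y) = 0"
        unfolding H_def by (rule correlation_antisymmetric[OF f g weak])
      with even show "AE y in lborel. b (- y) * H (- y) = - (b y * H y)"
      proof eventually_elim
        case (elim y)
        then have "H (- y) = - H y" by (simp add: add_eq_0_iff)
        then show ?case using elim by simp
      qed
    qed measurable
    finally show ?thesis unfolding I by simp
  qed
  ultimately show ?thesis by (simp add: has_bochner_integral_iff)
qed

text \<open>Reflection of the variable transfers evenness to the transform. For real
  \<open>b\<close> conjugation sends \<open>\<xi>\<close> to \<open>- \<xi>\<close>, so evenness
  makes the value self-conjugate.\<close>

lemma fourier_real_even:
  assumes b: "integrable lborel b" and re: "AE x in lborel. b x \<in> \<real> \<and> b (- x) = b x"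
  shows "fourier b (- \<xi>) = fourier b \<xi>" "fourier b \<xi> \<in> \<real>"
proof -
  have [measurable]: "b \<in> borel_measurable borel" using b by auto
  have "fourier b \<xi> = (LINT x|lborel. cis (- (- x \<bullet> \<xi>)) * b (- x))"
    unfolding fourier_def by (rule lborel_integral_translate(4)[symmetric]) measurable
  also have "\<dots> = fourier b (- \<xi>)"
    unfolding fourier_def using re by (intro integral_cong_AE) auto
  finally show 1: "fourier b (- \<xi>) = fourier b \<xi>" by simp
  have [measurable]: "cnj \<in> borel_measurable borel"
    by (intro borel_measurable_continuous_onI continuous_intros)
  have "cnj (fourier b \<xi>) = (LINT x|lborel. cnj (cis (- (x \<bullet> \<xi>)) * b x))"
    unfolding fourier_def by (rule Bochner_Integration.integral_cnj[symmetric])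
  also have "\<dots> = fourier b (- \<xi>)"
    unfolding fourier_def using re
    by (intro integral_cong_AE) (auto simp: cis_cnj Reals_cnj_iff)
  finally show "fourier b \<xi> \<in> \<real>" using 1 by (simp add: Reals_cnj_iff)
qed

subsection \<open>Symbols\<close>

lemma cfield_square_integrable:
  assumes "integrable lborel (cfield w k)" and w: "integrable lborel (\<lambda>x. (norm (w x))\<^sup>2)"
  shows "integrable lborel (\<lambda>x. (norm (cfield w k x))\<^sup>2)"
proof (rule Bochner_Integration.integrable_bound[OF w])
  have [measurable]: "cfield w k \<in> borel_measurable borel" using assms(1) by auto
  show "(\<lambda>x. (norm (cfield w k x))\<^sup>2) \<in> borel_measurable lborel" by measurable
  show "AE x in lborel. norm ((norm (cfield w k x))\<^sup>2) \<le> norm ((norm (w x))\<^sup>2)"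
    using component_le_norm_cart[of "w _" k]
    by (intro AE_I2) (simp add: cfield_def abs_le_square_iff[symmetric])
qed

lemma preserves_high_frequency_scaling_bounded:
  assumes \<nu>: "0 < \<nu>" and \<sigma>: "bounded (range \<sigma>)"
  shows "preserves_high_frequency_scaling \<nu> \<sigma>"
proof -
  obtain B where B: "\<And>\<xi>. norm (\<sigma> \<xi>) \<le> B" using \<sigma> by (auto simp: bounded_iff)
  \<comment> \<open>Stated for any filter because it serves twice: for \<xi> going to infinity with
    denominator \<nu> |\<xi>|^2, and for the parabolic rescaling with denominator
    \<open>s\<^sup>2\<close>.\<close>
  have quotient: "((\<lambda>x. \<sigma> (p x) / complex_of_real (q x)) \<longlongrightarrow> 0) F"
    if q: "filterlim q at_top F" for p and q :: "'b \<Rightarrow> real" and F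
  proof (rule Lim_null_comparison)
    show "((\<lambda>x. B / \<bar>q x\<bar>) \<longlongrightarrow> 0) F"
      by (intro real_tendsto_divide_at_top[OF tendsto_const] filterlim_compose[OF filterlim_abs_real q])
    show "eventually (\<lambda>x. norm (\<sigma> (p x) / complex_of_real (q x)) \<le> B / \<bar>q x\<bar>) F"
      using B by (intro always_eventually allI) (simp add: norm_divide divide_right_mono)
  qed
  have sq: "filterlim (\<lambda>r::real. r\<^sup>2) at_top at_top"
    by (rule filterlim_pow_at_top) (auto simp: filterlim_ident)
  have "filterlim (\<lambda>\<xi>::R3. \<nu> * (norm \<xi>)\<^sup>2) at_top at_infinity"
    by (rule filterlim_tendsto_pos_mult_at_top[OF tendsto_const \<nu> filterlim_compose[OF sq filterlim_norm_at_top]])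
  then have "((\<lambda>\<xi>. 1 - \<sigma> \<xi> / complex_of_real (\<nu> * (norm \<xi>)\<^sup>2)) \<longlongrightarrow> 1 - 0) at_infinity"
    by (intro tendsto_diff tendsto_const quotient)
  moreover have "eventually (\<lambda>\<xi>::R3. \<xi> \<noteq> 0) at_infinity"
    by (auto simp: eventually_at_infinity intro!: exI[of _ 1])
  then have "eventually (\<lambda>\<xi>. 1 - \<sigma> \<xi> / complex_of_real (\<nu> * (norm \<xi>)\<^sup>2) =
     (complex_of_real (- \<nu> * (norm \<xi>)\<^sup>2) + \<sigma> \<xi>) / complex_of_real (- \<nu> * (norm \<xi>)\<^sup>2)) at_infinity"
    by eventually_elim (use \<nu> in \<open>simp add: field_simps\<close>)
  ultimately have "((\<lambda>\<xi>. (complex_of_real (- \<nu> * (norm \<xi>)\<^sup>2) + \<sigma> \<xi>) / complex_of_real (- \<nu> * (norm \<xi>)\<^sup>2)) \<longlongrightarrow> 1) at_infinity"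
    using Lim_transform_eventually by force
  then have "(\<lambda>\<xi>. complex_of_real (- \<nu> * (norm \<xi>)\<^sup>2) + \<sigma> \<xi>)
        \<sim>[at_infinity] (\<lambda>\<xi>. complex_of_real (- \<nu> * (norm \<xi>)\<^sup>2))"
    by (rule asymp_equivI')
  moreover have "((\<lambda>s. (complex_of_real (- \<nu> * (norm (s *\<^sub>R \<xi>))\<^sup>2) + \<sigma> (s *\<^sub>R \<xi>)) / complex_of_real (s\<^sup>2))
        \<longlongrightarrow> complex_of_real (- \<nu> * (norm \<xi>)\<^sup>2)) at_top" for \<xi>
  proof -
    have "((\<lambda>s. complex_of_real (- \<nu> * (norm \<xi>)\<^sup>2) + \<sigma> (s *\<^sub>R \<xi>) / complex_of_real (s\<^sup>2))
        \<longlongrightarrow> complex_of_real (- \<nu> * (norm \<xi>)\<^sup>2) + 0) at_top"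
      by (intro tendsto_add tendsto_const quotient sq)
    moreover have "eventually (\<lambda>s. complex_of_real (- \<nu> * (norm \<xi>)\<^sup>2) + \<sigma> (s *\<^sub>R \<xi>) / complex_of_real (s\<^sup>2)
       = (complex_of_real (- \<nu> * (norm (s *\<^sub>R \<xi>))\<^sup>2) + \<sigma> (s *\<^sub>R \<xi>)) / complex_of_real (s\<^sup>2)) at_top"
      using eventually_gt_at_top[of 0]
      by eventually_elim (simp add: power_mult_distrib field_simps)
    ultimately show ?thesis using Lim_transform_eventually by force
  qed
  ultimately show ?thesis unfolding preserves_high_frequency_scaling_def by blast
qed

lemma stronger_than_laplacianI:
  assumes \<alpha>: "1 < \<alpha>" and c: "0 < c" and lb: "\<And>\<xi>. c * norm \<xi> powr (2 * \<alpha>) \<le> Re (- \<sigma> \<xi>)"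
  shows "stronger_than_laplacian \<sigma>"
  unfolding stronger_than_laplacian_def
proof (rule filterlim_at_top_mono)
  have "filterlim (\<lambda>r. c * r powr (2 * \<alpha> - 2)) at_top at_top"
    using \<alpha> c by real_asymp
  then show "filterlim (\<lambda>\<xi>::R3. c * norm \<xi> powr (2 * \<alpha> - 2)) at_top at_infinity"
    by (rule filterlim_compose[OF _ filterlim_norm_at_top])
  have "c * norm \<xi> powr (2 * \<alpha> - 2) \<le> Re (- \<sigma> \<xi>) / (norm \<xi>)\<^sup>2" if "\<xi> \<noteq> 0" for \<xi>
    using that divide_right_mono[OF lb[of \<xi>], of "(norm \<xi>)\<^sup>2"] by (simp add: powr_diff)
  moreover have "eventually (\<lambda>\<xi>::R3. \<xi> \<noteq> 0) at_infinity"
    by (auto simp: eventually_at_infinity intro!: exI[of _ 1])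
  ultimately show "eventually (\<lambda>\<xi>. c * norm \<xi> powr (2 * \<alpha> - 2) \<le> Re (- \<sigma> \<xi>) / (norm \<xi>)\<^sup>2) at_infinity"
    by (auto elim: eventually_mono)
qed

lemma hyperdissipativeI:
  assumes \<alpha>: "1 < \<alpha>" and c: "0 < c" and lb: "\<And>\<xi>. c * norm \<xi> powr (2 * \<alpha>) \<le> Re (- \<sigma> \<xi>)"
    and ub: "\<And>\<xi>. Re (- \<sigma> \<xi>) \<le> C * (1 + norm \<xi> powr (2 * \<alpha>))"
  shows "hyperdissipative \<alpha> \<sigma>"
proof -
  \<comment> \<open>The maximum secures the order \<open>c0 \<le> c1\<close> of the two constants,
    since \<open>C\<close> comes with no relation to \<open>c\<close>.\<close>
  have "Re (- \<sigma> \<xi>) \<le> max c C * (1 + norm \<xi> powr (2 * \<alpha>))" for \<xi>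
    by (rule order_trans[OF ub]) (intro mult_right_mono; simp)
  then have "dissipation_comparable \<alpha> \<sigma>"
    unfolding dissipation_comparable_def using c lb by (intro exI[of _ c] exI[of _ "max c C"]) auto
  then show ?thesis
    unfolding hyperdissipative_def using \<alpha> stronger_than_laplacianI[OF \<alpha> c lb] by blast
qed

lemma norm_power2_eq_sum: "(norm (x :: real ^ 'n))\<^sup>2 = (\<Sum>j\<in>UNIV. (x $ j)\<^sup>2)"
  by (simp add: norm_vec_def L2_set_def sum_nonneg)

text \<open>In the third part a lower bound on \<open>Re chat\<close> leaves faster growth possible,
  so it cannot give the upper half of comparability for \<open>\<sigma>_sum\<close>. The summed
  lower bound itself is therefore the symbol shown hyperdissipative outright; for
  \<open>\<sigma>_sum\<close> this follows under a matching upper bound on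
  \<open>Re chat\<close>.\<close>

theorem proposition3p1:
  fixes u :: "real ^ 3 \<Rightarrow> real ^ 3" and \<nu> :: real
  assumes "0 < \<nu>" and "integrable lborel u" and "divergence_free u"
  shows
    "(\<forall>a. integrable lborel a \<longrightarrow>
        (let \<sigma> = (\<lambda>\<xi>. fourier a \<xi>) in
          multiplier_relation (\<lambda>k. conv a (cfield u k)) u \<sigma> \<and>
          order_zero \<sigma> \<and>
          preserves_high_frequency_scaling \<nu> \<sigma>))
   \<and> (\<forall>b j. integrable lborel b \<longrightarrow>
        (let \<sigma> = (\<lambda>\<xi>. \<i> * complex_of_real (\<xi> $ j) * fourier b \<xi>) in
          (\<forall>v. weak_deriv [j] u v \<longrightarrow>
             multiplier_relation (\<lambda>k. conv b (cfield v k)) u \<sigma>) \<and>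
          at_most_first_order \<sigma> \<and>
          ((AE x in lborel. b x \<in> \<real> \<and> b (- x) = b x) \<longrightarrow>
             (\<forall>\<xi>. fourier b \<xi> \<in> \<real> \<and> fourier b (- \<xi>) = fourier b \<xi>) \<and>
             (\<forall>\<xi>. Re (\<sigma> \<xi>) = 0) \<and>
             (\<forall>v. weak_deriv [j] u v \<longrightarrow>
                integrable lborel (\<lambda>x. (norm (u x))\<^sup>2) \<longrightarrow>
                integrable lborel (\<lambda>x. (norm (v x))\<^sup>2) \<longrightarrow>
                has_bochner_integral lborel
                  (\<lambda>x. \<Sum>k\<in>UNIV. conv b (cfield v k) x * cfield u k x) 0))))
   \<and> (\<forall>c chat \<alpha> c_star.
        tempered_distribution c \<longrightarrow> has_dist_fourier c chat \<longrightarrow>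
        1 < \<alpha> \<longrightarrow> 0 < c_star \<longrightarrow>
        (\<forall>\<xi>. c_star * norm \<xi> powr (2 * \<alpha> - 2) \<le> Re (chat \<xi>)) \<longrightarrow>
        (let \<sigma> = (\<lambda>j \<xi>. - complex_of_real ((\<xi> $ j)\<^sup>2) * chat \<xi>);
             \<sigma>_sum = (\<lambda>\<xi>. \<Sum>j\<in>UNIV. \<sigma> j \<xi>);
             lower = (\<lambda>j \<xi>. c_star * (\<xi> $ j)\<^sup>2 * norm \<xi> powr (2 * \<alpha> - 2)) in
          (\<forall>j v. weak_deriv [j, j] u v \<longrightarrow>
             dist_multiplier_relation (\<lambda>k. dist_conv c (cfield v k)) u (\<sigma> j)) \<and>
          (\<forall>j \<xi>. Re (- \<sigma> j \<xi>) = (\<xi> $ j)\<^sup>2 * Re (chat \<xi>) \<and> lower j \<xi> \<le> Re (- \<sigma> j \<xi>)) \<and>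
          (\<forall>v. (\<forall>j. weak_deriv [j, j] u (v j)) \<longrightarrow>
             dist_multiplier_relation
               (\<lambda>k \<phi>. \<Sum>j\<in>UNIV. dist_conv c (cfield (v j) k) \<phi>) u \<sigma>_sum) \<and>
          (\<forall>\<xi>. (\<Sum>j\<in>UNIV. lower j \<xi>) = c_star * norm \<xi> powr (2 * \<alpha>)) \<and>
          hyperdissipative \<alpha> (\<lambda>\<xi>. - complex_of_real (\<Sum>j\<in>UNIV. lower j \<xi>)) \<and>
          (\<forall>\<xi>. c_star * norm \<xi> powr (2 * \<alpha>) \<le> Re (- \<sigma>_sum \<xi>)) \<and>
          stronger_than_laplacian \<sigma>_sum \<and>
          ((\<exists>C. \<forall>\<xi>. Re (chat \<xi>) \<le> C * (1 + norm \<xi> powr (2 * \<alpha> - 2))) \<longrightarrow>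
             hyperdissipative \<alpha> \<sigma>_sum)))"
proof -
  have u: "integrable lborel (cfield u k)" for k by (rule cfield_integrable[OF assms(2)])
  have part1: "multiplier_relation (\<lambda>k. conv a (cfield u k)) u (fourier a)"
    "order_zero (fourier a)" "preserves_high_frequency_scaling \<nu> (fourier a)"
    if a: "integrable lborel a" for a
  proof -
    show "multiplier_relation (\<lambda>k. conv a (cfield u k)) u (fourier a)"
      unfolding multiplier_relation_def using conv_integrable[OF a u] fourier_conv[OF a u] by blast
    show "order_zero (fourier a)"
      unfolding order_zero_def bounded_iff using fourier_norm_le[OF a] by blast
    then show "preserves_high_frequency_scaling \<nu> (fourier a)"
      unfolding order_zero_def by (rule preserves_high_frequency_scaling_bounded[OF assms(1)])
  qed
  have part2: "(\<forall>v. weak_deriv [j] u v \<longrightarrow> multiplier_relation (\<lambda>k. conv b (cfield v k)) u \<sigma>)"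
    "at_most_first_order \<sigma>"
    "(AE x in lborel. b x \<in> \<real> \<and> b (- x) = b x) \<longrightarrow>
             (\<forall>\<xi>. fourier b \<xi> \<in> \<real> \<and> fourier b (- \<xi>) = fourier b \<xi>) \<and>
             (\<forall>\<xi>. Re (\<sigma> \<xi>) = 0) \<and>
             (\<forall>v. weak_deriv [j] u v \<longrightarrow>
                integrable lborel (\<lambda>x. (norm (u x))\<^sup>2) \<longrightarrow>
                integrable lborel (\<lambda>x. (norm (v x))\<^sup>2) \<longrightarrow>
                has_bochner_integral lborel
                  (\<lambda>x. \<Sum>k\<in>UNIV. conv b (cfield v k) x * cfield u k x) 0)"
    if b: "integrable lborel b" and \<sigma>: "\<sigma> = (\<lambda>\<xi>. \<i> * complex_of_real (\<xi> $ j) * fourier b \<xi>)"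
    for b j \<sigma>
  proof -
    show "\<forall>v. weak_deriv [j] u v \<longrightarrow> multiplier_relation (\<lambda>k. conv b (cfield v k)) u \<sigma>"
    proof (intro allI impI)
      fix v assume v: "weak_deriv [j] u v"
      then have vi: "integrable lborel (cfield v k)" for k
        by (auto simp: weak_deriv_def intro: cfield_integrable)
      show "multiplier_relation (\<lambda>k. conv b (cfield v k)) u \<sigma>"
        unfolding multiplier_relation_def
        using conv_integrable[OF b vi] fourier_conv[OF b vi] fourier_weak_deriv[OF v]
        by (simp add: \<sigma> mult_ac)
    qed
    have "norm (\<sigma> \<xi>) \<le> (LINT x|lborel. norm (b x)) * norm \<xi>" for \<xi>
      using fourier_norm_le[OF b, of \<xi>] component_le_norm_cart[of \<xi> j]
      by (simp add: \<sigma> norm_mult) (subst mult.commute, intro mult_mono, auto)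
    then show "at_most_first_order \<sigma>" unfolding at_most_first_order_def by blast
    show "(AE x in lborel. b x \<in> \<real> \<and> b (- x) = b x) \<longrightarrow>
             (\<forall>\<xi>. fourier b \<xi> \<in> \<real> \<and> fourier b (- \<xi>) = fourier b \<xi>) \<and>
             (\<forall>\<xi>. Re (\<sigma> \<xi>) = 0) \<and>
             (\<forall>v. weak_deriv [j] u v \<longrightarrow>
                integrable lborel (\<lambda>x. (norm (u x))\<^sup>2) \<longrightarrow>
                integrable lborel (\<lambda>x. (norm (v x))\<^sup>2) \<longrightarrow>
                has_bochner_integral lborel
                  (\<lambda>x. \<Sum>k\<in>UNIV. conv b (cfield v k) x * cfield u k x) 0)"
    proof (intro impI conjI allI)
      assume re: "AE x in lborel. b x \<in> \<real> \<and> b (- x) = b x"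
      fix \<xi> show "fourier b \<xi> \<in> \<real>" "fourier b (- \<xi>) = fourier b \<xi>"
        using fourier_real_even[OF b re] by auto
      then show "Re (\<sigma> \<xi>) = 0" by (simp add: \<sigma> complex_is_Real_iff)
    next
      assume re: "AE x in lborel. b x \<in> \<real> \<and> b (- x) = b x"
      fix v assume v: "weak_deriv [j] u v" and u2: "integrable lborel (\<lambda>x. (norm (u x))\<^sup>2)"
        and v2: "integrable lborel (\<lambda>x. (norm (v x))\<^sup>2)"
      \<comment> \<open>The energy vanishes component by component, with no cancellation between
        different \<open>k\<close>.\<close>
      have "has_bochner_integral lborel (\<lambda>x. conv b (cfield v k) x * cfield u k x) 0" for k
      proof (rule even_convolution_derivative_energy[OF b u])
        show "integrable lborel (cfield v k)"
          using v by (auto simp: weak_deriv_def intro: cfield_integrable)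
        then show "integrable lborel (\<lambda>x. (cmod (cfield u k x))\<^sup>2)" "integrable lborel (\<lambda>x. (cmod (cfield v k x))\<^sup>2)"
          using u[of k] u2 v2 by (auto intro: cfield_square_integrable)
        show "AE x in lborel. b (- x) = b x" using re by eventually_elim simp
        show "(LINT x|lborel. cfield v k x * \<phi> x) = - (LINT x|lborel. cfield u k x * pd j \<phi> x)"
          if "schwartz \<phi>" for \<phi>
          using v that by (simp add: weak_deriv_def pds_Cons)
      qed
      then have "has_bochner_integral lborel (\<lambda>x. \<Sum>k\<in>UNIV. conv b (cfield v k) x * cfield u k x) (\<Sum>k\<in>(UNIV::3 set). 0)"
        by (intro has_bochner_integral_sum)
      then show "has_bochner_integral lborel (\<lambda>x. \<Sum>k\<in>UNIV. conv b (cfield v k) x * cfield u k x) 0"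
        by simp
    qed
  qed
  \<comment> \<open>The abbreviations enter as equations, to be discharged by \<open>refl\<close>
    once the \<open>let\<close> of the statement is unfolded.\<close>
  have part3:
    "(\<forall>j v. weak_deriv [j, j] u v \<longrightarrow>
             dist_multiplier_relation (\<lambda>k. dist_conv c (cfield v k)) u (\<sigma> j)) \<and>
          (\<forall>j \<xi>. Re (- \<sigma> j \<xi>) = (\<xi> $ j)\<^sup>2 * Re (chat \<xi>) \<and> lower j \<xi> \<le> Re (- \<sigma> j \<xi>)) \<and>
          (\<forall>v. (\<forall>j. weak_deriv [j, j] u (v j)) \<longrightarrow>
             dist_multiplier_relation
               (\<lambda>k \<phi>. \<Sum>j\<in>UNIV. dist_conv c (cfield (v j) k) \<phi>) u \<sigma>_sum) \<and>
          (\<forall>\<xi>. (\<Sum>j\<in>UNIV. lower j \<xi>) = c_star * norm \<xi> powr (2 * \<alpha>)) \<and>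
          hyperdissipative \<alpha> (\<lambda>\<xi>. - complex_of_real (\<Sum>j\<in>UNIV. lower j \<xi>)) \<and>
          (\<forall>\<xi>. c_star * norm \<xi> powr (2 * \<alpha>) \<le> Re (- \<sigma>_sum \<xi>)) \<and>
          stronger_than_laplacian \<sigma>_sum \<and>
          ((\<exists>C. \<forall>\<xi>. Re (chat \<xi>) \<le> C * (1 + norm \<xi> powr (2 * \<alpha> - 2))) \<longrightarrow>
             hyperdissipative \<alpha> \<sigma>_sum)"
    if c: "has_dist_fourier c chat" and \<alpha>: "1 < \<alpha>" and c_star: "0 < c_star"
      and lb: "\<forall>\<xi>. c_star * norm \<xi> powr (2 * \<alpha> - 2) \<le> Re (chat \<xi>)"
      and \<sigma>: "\<sigma> = (\<lambda>j \<xi>. - complex_of_real ((\<xi> $ j)\<^sup>2) * chat \<xi>)"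
      and \<sigma>_sum: "\<sigma>_sum = (\<lambda>\<xi>. \<Sum>j\<in>UNIV. \<sigma> j \<xi>)"
      and lower: "lower = (\<lambda>j \<xi>. c_star * (\<xi> $ j)\<^sup>2 * norm \<xi> powr (2 * \<alpha> - 2))"
    for c chat \<alpha> c_star \<sigma> \<sigma>_sum and lower :: "3 \<Rightarrow> R3 \<Rightarrow> real"
  proof (intro conjI allI impI)
    have tc: "tempered_fun chat" using c by (simp add: has_dist_fourier_def)
    have single: "has_dist_fourier (dist_conv c (cfield v k)) (\<lambda>\<xi>. \<sigma> j \<xi> * fourier (cfield u k) \<xi>)"
      if v: "weak_deriv [j, j] u v" for j v k
    proof -
      have "integrable lborel (cfield v k)"
        using v by (auto simp: weak_deriv_def intro: cfield_integrable)
      \<comment> \<open>The list \<open>[j, j]\<close> contributes the square of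
        \<open>\<i> * \<xi> $ j\<close>, which is the source of the minus sign in
        \<open>\<sigma> j\<close>.\<close>
      from dist_conv_fourier[OF c this] show ?thesis
        by (simp add: fourier_weak_deriv[OF v] \<sigma> power2_eq_square mult_ac)
    qed
    then show "dist_multiplier_relation (\<lambda>k. dist_conv c (cfield v k)) u (\<sigma> j)"
      if "weak_deriv [j, j] u v" for j v
      using that by (simp add: dist_multiplier_relation_def)
    have sum_eq: "\<sigma>_sum \<xi> = - complex_of_real ((norm \<xi>)\<^sup>2) * chat \<xi>" for \<xi>
      by (simp only: \<sigma>_sum \<sigma> sum_distrib_right[symmetric] sum_negf norm_power2_eq_sum of_real_sum)
    show "dist_multiplier_relation (\<lambda>k \<phi>. \<Sum>j\<in>UNIV. dist_conv c (cfield (v j) k) \<phi>) u \<sigma>_sum"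
      if v: "\<forall>j. weak_deriv [j, j] u (v j)" for v
      unfolding dist_multiplier_relation_def
    proof
      fix k
      \<comment> \<open>Summed over \<open>j\<close>, the squared coordinates become |\<xi>|^2. The
        factor of \<open>chat\<close> then grows at most quadratically, its constant being the
        integral of the norm of the component of \<open>u\<close>.\<close>
      have "tempered_fun (\<lambda>\<xi>. (- complex_of_real ((norm \<xi>)\<^sup>2) * fourier (cfield u k) \<xi>) * chat \<xi>)"
      proof (rule tempered_fun_mult_bounded[OF tc])
        show "(\<lambda>\<xi>. - complex_of_real ((norm \<xi>)\<^sup>2) * fourier (cfield u k) \<xi>) \<in> borel_measurable borel"
          using fourier_borel[OF u[of k]] by measurable
        fix \<xi> :: R3
        have "(norm \<xi>)\<^sup>2 * norm (fourier (cfield u k) \<xi>) \<le> (1 + norm \<xi>)\<^sup>2 * (LINT x|lborel. norm (cfield u k x))"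
          by (intro mult_mono power_mono fourier_norm_le u) auto
        then show "norm (- complex_of_real ((norm \<xi>)\<^sup>2) * fourier (cfield u k) \<xi>)
          \<le> (LINT x|lborel. norm (cfield u k x)) * (1 + norm \<xi>)\<^sup>2"
          by (simp add: norm_mult norm_power mult.commute)
      qed
      then have t: "tempered_fun (\<lambda>\<xi>. \<Sum>j\<in>UNIV. \<sigma> j \<xi> * fourier (cfield u k) \<xi>)"
        using sum_eq unfolding \<sigma>_sum by (simp add: mult_ac flip: sum_distrib_left sum_distrib_right)
      show "has_dist_fourier (\<lambda>\<phi>. \<Sum>j\<in>UNIV. dist_conv c (cfield (v j) k) \<phi>) (\<lambda>\<xi>. \<sigma>_sum \<xi> * fourier (cfield u k) \<xi>)"
        unfolding \<sigma>_sum sum_distrib_right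
        by (rule has_dist_fourier_sum[OF _ t]) (use v single in auto)
    qed
    show re: "Re (- \<sigma> j \<xi>) = (\<xi> $ j)\<^sup>2 * Re (chat \<xi>)" for j \<xi>
      by (simp add: \<sigma> flip: of_real_power)
    show "lower j \<xi> \<le> Re (- \<sigma> j \<xi>)" for j \<xi>
      unfolding re lower using mult_left_mono[OF lb[rule_format, of \<xi>], of "(\<xi> $ j)\<^sup>2"]
      by (simp add: mult_ac)
    \<comment> \<open>The origin is separate because the exponent law divides by |\<xi>|^2; there
      both sides are 0, as \<open>0 powr a = 0\<close>.\<close>
    have powr: "norm \<xi> powr (2 * \<alpha>) = (norm \<xi>)\<^sup>2 * norm \<xi> powr (2 * \<alpha> - 2)" for \<xi> :: R3
      by (cases "\<xi> = 0") (simp_all add: powr_diff)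
    show lsum: "(\<Sum>j\<in>UNIV. lower j \<xi>) = c_star * norm \<xi> powr (2 * \<alpha>)" for \<xi>
      unfolding lower powr norm_power2_eq_sum
      by (simp add: sum_distrib_left sum_distrib_right mult_ac)
    show "hyperdissipative \<alpha> (\<lambda>\<xi>. - complex_of_real (\<Sum>j\<in>UNIV. lower j \<xi>))"
      unfolding lsum
      by (rule hyperdissipativeI[OF \<alpha> c_star, where C = c_star]) (use c_star in \<open>auto simp: distrib_left\<close>)
    have re_sum: "Re (- \<sigma>_sum \<xi>) = (norm \<xi>)\<^sup>2 * Re (chat \<xi>)" for \<xi>
      by (simp add: sum_eq flip: of_real_power)
    show sum_lb: "c_star * norm \<xi> powr (2 * \<alpha>) \<le> Re (- \<sigma>_sum \<xi>)" for \<xi>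
      unfolding re_sum powr using mult_left_mono[OF lb[rule_format, of \<xi>], of "(norm \<xi>)\<^sup>2"]
      by (simp add: mult_ac)
    show "stronger_than_laplacian \<sigma>_sum"
      by (rule stronger_than_laplacianI[OF \<alpha> c_star sum_lb])
    assume "\<exists>C. \<forall>\<xi>. Re (chat \<xi>) \<le> C * (1 + norm \<xi> powr (2 * \<alpha> - 2))"
    then obtain C where C: "\<And>\<xi>. Re (chat \<xi>) \<le> C * (1 + norm \<xi> powr (2 * \<alpha> - 2))" by blast
    \<comment> \<open>The absolute value is there because \<open>C\<close> has no assumed sign. The
      factor 2 absorbs the lower-order term, through |\<xi>|^2 \<le> 1 +
      |\<xi>|^(2\<alpha>).\<close>
    have "Re (- \<sigma>_sum \<xi>) \<le> (2 * \<bar>C\<bar>) * (1 + norm \<xi> powr (2 * \<alpha>))" for \<xi>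
    proof -
      have "C * (1 + norm \<xi> powr (2 * \<alpha> - 2)) \<le> \<bar>C\<bar> * (1 + norm \<xi> powr (2 * \<alpha> - 2))"
        by (intro mult_right_mono) auto
      then have "Re (- \<sigma>_sum \<xi>) \<le> (norm \<xi>)\<^sup>2 * (\<bar>C\<bar> * (1 + norm \<xi> powr (2 * \<alpha> - 2)))"
        unfolding re_sum using C[of \<xi>] by (intro mult_left_mono) auto
      also have "\<dots> = \<bar>C\<bar> * ((norm \<xi>)\<^sup>2 + norm \<xi> powr (2 * \<alpha>))"
        unfolding powr by (simp add: algebra_simps)
      also have "(norm \<xi>)\<^sup>2 \<le> 1 + norm \<xi> powr (2 * \<alpha>)"
      proof (cases "norm \<xi> \<le> 1")
        case True
        then have "(norm \<xi>)\<^sup>2 \<le> 1" by (simp add: power_le_one)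
        then show ?thesis by (simp add: add_increasing2)
      next
        case False
        then have "1 \<le> norm \<xi> powr (2 * \<alpha> - 2)" using \<alpha> by (intro ge_one_powr_ge_zero) auto
        then have "(norm \<xi>)\<^sup>2 * 1 \<le> norm \<xi> powr (2 * \<alpha>)"
          unfolding powr by (intro mult_left_mono) auto
        then show ?thesis by simp
      qed
      then have "\<bar>C\<bar> * ((norm \<xi>)\<^sup>2 + norm \<xi> powr (2 * \<alpha>)) \<le> \<bar>C\<bar> * (2 * (1 + norm \<xi> powr (2 * \<alpha>)))"
        by (intro mult_left_mono) auto
      also have "\<bar>C\<bar> * (2 * (1 + norm \<xi> powr (2 * \<alpha>))) = 2 * \<bar>C\<bar> * (1 + norm \<xi> powr (2 * \<alpha>))"
        by (simp only: mult.assoc mult.left_commute)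
      finally show ?thesis .
    qed
    then show "hyperdissipative \<alpha> \<sigma>_sum"
      by (rule hyperdissipativeI[OF \<alpha> c_star sum_lb])
  qed
  show ?thesis
    unfolding Let_def
  proof ((rule conjI[OF _ conjI]; intro allI impI), goal_cases)
    case (1 a)
    show ?case by (intro conjI part1[OF 1])
  next
    case (2 b j)
    show ?case by (intro conjI part2[OF 2 refl])
  next
    case (3 c chat \<alpha> c_star)
    show ?case by (rule part3[OF 3(2-5) refl refl refl])
  qed
qed

end
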